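(* Let $n\ge1$, let $H\in\mathbb{R}^{n\times n}$ be symmetric, let $c\in\mathbb{R}^n$, and let $(\mathrm{TRS})$ be the problem $\min\{\frac12x^THx+c^Tx:\ x\in\mathbb{R}^n,\ x^Tx\le1\}$. Let $\eta\in(0,2/\|H\|_2)$ and let $\{(x^k,y^k)\}_{k=0}^\infty$ be generated from $(x^0,y^0)$, uniformly and randomly selected from $B_{2n}=\{(x,y)\in\mathbb{R}^n\times\mathbb{R}^n:\ x^Tx+y^Ty\le1\}$, by $$\bar x^k=x^k-\eta(Hx^k+c),\quad \bar y^k=y^k-\eta Hy^k,\quad d^k=\sqrt{\|\bar x^k\|^2+\|\bar y^k\|^2},\quad (x^{k+1},y^{k+1})=\frac{(\bar x^k,\bar y^k)}{\max\{d^k,1\}}.$$ Then, with probability one, $\{(x^k,y^k)\}$ converges to a point $(\tilde x,\tilde y)$ which is a global minimizer of $$(\mathrm{D})\quad \min\{F(x,y)=\tfrac12x^THx+\tfrac12y^THy+c^Tx:\ (x,y)\in B_{2n}\},$$ and from which a global minimizer $x^*$ of (TRS) is constructed by setting $x^*=\tilde x$ if $\tilde y=0$, and $$x^*=\tilde x+\frac{\sqrt{(\tilde x^T\tilde y)^2-\tilde y^T\tilde y(\tilde x^T\tilde x-1)}-\tilde x^T\tilde y}{\tilde y^T\tilde y}\tilde y$$ if $\tilde y\neq0$. Moreover, in this event, with $F^*$ the optimal value of (D), the local convergence rate is linear in the "well case" of (TRS) and sublinear in the "ill case" of (TRS), in the following sense. In the well case, there exist an integer $K\ge 0$ and constants $C\ge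 0$, $\rho\in(0,1)$ such that $F(x^k,y^k)-F^*\le C\rho^{k}$ for all $k\ge K$. In the ill case, there exist an integer $K\ge 1$ and a constant $C\ge 0$ such that $F(x^k,y^k)-F^*\le C/k^2$ for all $k\ge K$.
   Context: $\|H\|_2$ is the spectral norm, $\|\cdot\|$ the Euclidean norm, $\lambda_1$ the minimum eigenvalue of $H$, and $\dagger$ the Moore–Penrose pseudoinverse. For any global minimizer $x$ of (TRS) there is a unique $\lambda^*\ge0$ (the same for all global minimizers) with $(H+\lambda^*I)x+c=0$ and $\lambda^*(x^Tx-1)=0$. The "ill case" of (TRS) means: $c\in\mathrm{Range}(H-\lambda_1I)$, $\lambda^*=-\lambda_1$ and $\|(H-\lambda_1I)^\dagger c\|=1$. The "well case" means that the ill case does not hold. *)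

theory Defs
  imports "HOL-Probability.Probability"
begin

section \<open>Eigenvalues and the pseudoinverse\<close>

definition is_eigenvalue :: "real ^ 'n ^ 'n \<Rightarrow> real \<Rightarrow> bool" where
  "is_eigenvalue H l \<longleftrightarrow> (\<exists>v. v \<noteq> 0 \<and> H *v v = l *\<^sub>R v)"

definition min_eigenvalue :: "real ^ 'n ^ 'n \<Rightarrow> real" where
  "min_eigenvalue H = (LEAST l. is_eigenvalue H l)"

text \<open>The four Penrose conditions, which determine the Moore--Penrose pseudoinverse of a real
  square matrix uniquely.\<close>

definition is_pseudoinverse :: "real ^ 'n ^ 'n \<Rightarrow> real ^ 'n ^ 'n \<Rightarrow> bool" where
  "is_pseudoinverse A P \<longleftrightarrow>
     A ** P ** A = A \<and> P ** A ** P = P \<and>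
     transpose (A ** P) = A ** P \<and> transpose (P ** A) = P ** A"

definition pseudoinverse :: "real ^ 'n ^ 'n \<Rightarrow> real ^ 'n ^ 'n" where
  "pseudoinverse A = (THE P. is_pseudoinverse A P)"

section \<open>The trust region subproblem\<close>

definition trs_objective :: "real ^ 'n ^ 'n \<Rightarrow> real ^ 'n \<Rightarrow> real ^ 'n \<Rightarrow> real" where
  "trs_objective H c x = 1 / 2 * (x \<bullet> (H *v x)) + c \<bullet> x"

definition trs_minimizer :: "real ^ 'n ^ 'n \<Rightarrow> real ^ 'n \<Rightarrow> real ^ 'n \<Rightarrow> bool" where
  "trs_minimizer H c x \<longleftrightarrow> is_arg_min (trs_objective H c) (\<lambda>x. x \<bullet> x \<le> 1) x"

text \<open>The multiplier \<open>\<lambda>\<^sup>*\<close>. A global minimizer always exists by compactness, so the inner universal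
  quantifier is not vacuous and determines the multiplier uniquely.\<close>

definition trs_multiplier :: "real ^ 'n ^ 'n \<Rightarrow> real ^ 'n \<Rightarrow> real" where
  "trs_multiplier H c = (THE l. l \<ge> 0 \<and>
     (\<forall>x. trs_minimizer H c x \<longrightarrow> (H + mat l) *v x + c = 0 \<and> l * (x \<bullet> x - 1) = 0))"

definition ill_case :: "real ^ 'n ^ 'n \<Rightarrow> real ^ 'n \<Rightarrow> bool" where
  "ill_case H c \<longleftrightarrow>
     c \<in> range (\<lambda>x. (H - mat (min_eigenvalue H)) *v x) \<and>
     trs_multiplier H c = - min_eigenvalue H \<and>
     norm (pseudoinverse (H - mat (min_eigenvalue H)) *v c) = 1"

abbreviation well_case :: "real ^ 'n ^ 'n \<Rightarrow> real ^ 'n \<Rightarrow> bool" where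
  "well_case H c \<equiv> \<not> ill_case H c"

section \<open>The lifted problem and the projected gradient step\<close>

definition ball2n :: "((real ^ 'n) \<times> (real ^ 'n)) set" where
  "ball2n = {(x, y). x \<bullet> x + y \<bullet> y \<le> 1}"

definition dbl_objective :: "real ^ 'n ^ 'n \<Rightarrow> real ^ 'n \<Rightarrow> (real ^ 'n) \<times> (real ^ 'n) \<Rightarrow> real" where
  "dbl_objective H c = (\<lambda>(x, y). 1 / 2 * (x \<bullet> (H *v x)) + 1 / 2 * (y \<bullet> (H *v y)) + c \<bullet> x)"

definition dbl_minimizer :: "real ^ 'n ^ 'n \<Rightarrow> real ^ 'n \<Rightarrow> (real ^ 'n) \<times> (real ^ 'n) \<Rightarrow> bool" where
  "dbl_minimizer H c z \<longleftrightarrow> is_arg_min (dbl_objective H c) (\<lambda>z. z \<in> ball2n) z"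

definition dbl_optimal_value :: "real ^ 'n ^ 'n \<Rightarrow> real ^ 'n \<Rightarrow> real" where
  "dbl_optimal_value H c = (INF z\<in>ball2n. dbl_objective H c z)"

definition pg_step ::
  "real ^ 'n ^ 'n \<Rightarrow> real ^ 'n \<Rightarrow> real \<Rightarrow> (real ^ 'n) \<times> (real ^ 'n) \<Rightarrow> (real ^ 'n) \<times> (real ^ 'n)" where
  "pg_step H c \<eta> = (\<lambda>(x, y).
     let x' = x - \<eta> *\<^sub>R (H *v x + c);
         y' = y - \<eta> *\<^sub>R (H *v y);
         d = sqrt ((norm x')\<^sup>2 + (norm y')\<^sup>2)
     in ((1 / max d 1) *\<^sub>R x', (1 / max d 1) *\<^sub>R y'))"

definition recovered_point :: "real ^ 'n \<Rightarrow> real ^ 'n \<Rightarrow> real ^ 'n" where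
  "recovered_point x y =
     (if y = 0 then x
      else x + ((sqrt ((x \<bullet> y)\<^sup>2 - (y \<bullet> y) * (x \<bullet> x - 1)) - x \<bullet> y) / (y \<bullet> y)) *\<^sub>R y)"

end

theory Submission
  imports Defs
begin

text \<open>
  Write the iteration on the doubled space as \<open>z\<^sub>k\<^sub>+\<^sub>1 = (z\<^sub>k - \<eta> \<nabla>F(z\<^sub>k)) / m\<^sub>k\<close> with
  \<open>m\<^sub>k \<ge> 1\<close>. No stable manifold theorem is needed to avoid non-optimal critical points: if \<open>v\<close> is
  an eigenvector for the least eigenvalue \<open>\<lambda>\<^sub>1\<close> of \<open>H\<close>, then \<open>v\<^sup>Ty\<^sub>k\<close> is multiplied by
  \<open>(1 - \<eta> \<lambda>\<^sub>1) / m\<^sub>k\<close> in every step and stays bounded, so if \<open>v\<^sup>Ty\<^sub>0 \<noteq> 0\<close> (which holds almost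
  surely) then \<open>m\<^sub>k\<close> comes arbitrarily close to or above \<open>1 - \<eta> \<lambda>\<^sub>1\<close> infinitely often.
  A limit point along such indices is critical with multiplier \<open>\<lambda> \<ge> - \<lambda>\<^sub>1\<close>, hence a global
  minimiser, and by monotonicity the objective values converge to the optimum.

  The objective gap is then controlled by elementary error bounds for the positive semidefinite
  operator \<open>M = H + \<lambda>\<close> on the unit sphere. They give a Kurdyka--Lojasiewicz inequality with
  exponent 3/4, which improves to 1/2 when \<open>M\<close> is injective or the least norm solution of
  \<open>M a = - c\<close> lies inside the ball, that is, in the well case.
\<close>

section \<open>Error bounds for positive semidefinite operators\<close>

locale psd_operator =
  fixes M :: "'a::euclidean_space \<Rightarrow> 'a"
  assumes linear: "linear M"
    and self_adjoint: "\<And>u v. u \<bullet> M v = M u \<bullet> v"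
    and nonneg: "\<And>u. 0 \<le> u \<bullet> M u"
begin

section \<open>Spectral estimates obtained from the quadratic form\<close>

lemma norm_image_bound:
  "\<exists>B>0. (\<forall>u. norm (M u) \<le> B * norm u) \<and> (\<forall>u. (norm (M u))\<^sup>2 \<le> B * (u \<bullet> M u))"
proof -
  obtain B where B: "0 < B" "\<And>u. norm (M u) \<le> B * norm u"
    using linear_bounded_pos[OF linear] by blast
  have "(norm (M u))\<^sup>2 \<le> B * (u \<bullet> M u)" for u
  proof -
    \<comment> \<open>Nonnegativity of the form at \<open>u - t *\<^sub>R M u\<close> yields the
      second bound; \<open>t = 1 / B\<close> minimises the coefficient
      \<open>- 2 * t + B * t\<^sup>2\<close>.\<close>
    define t where "t = 1 / B"
    have "0 \<le> (u - t *\<^sub>R M u) \<bullet> M (u - t *\<^sub>R M u)"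
      by (rule nonneg)
    also have "\<dots> = u \<bullet> M u - 2 * t * (norm (M u))\<^sup>2 + t\<^sup>2 * (M u \<bullet> M (M u))"
      using self_adjoint[of u "M u"]
      by (simp add: linear_diff[OF linear] linear_scale[OF linear] inner_diff_left inner_diff_right
          power2_norm_eq_inner power2_eq_square[of t] algebra_simps inner_commute)
    also have "\<dots> \<le> u \<bullet> M u - 2 * t * (norm (M u))\<^sup>2 + t\<^sup>2 * (B * (norm (M u))\<^sup>2)"
    proof -
      have "M u \<bullet> M (M u) \<le> norm (M u) * norm (M (M u))"
        by (rule norm_cauchy_schwarz)
      also have "\<dots> \<le> norm (M u) * (B * norm (M u))"
        using B(2) by (intro mult_left_mono) auto
      finally have "M u \<bullet> M (M u) \<le> B * (norm (M u))\<^sup>2"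
        by (simp add: power2_eq_square mult_ac)
      then show ?thesis
        by (intro add_left_mono mult_left_mono) auto
    qed
    also have "\<dots> = u \<bullet> M u - (norm (M u))\<^sup>2 / B"
      using B(1) by (simp add: t_def power2_eq_square field_simps)
    finally show ?thesis
      using B(1) by (simp add: field_simps)
  qed
  with B show ?thesis
    by blast
qed

lemma kernel_iff: "u \<bullet> M u = 0 \<longleftrightarrow> M u = 0"
proof
  obtain B where "(norm (M u))\<^sup>2 \<le> B * (u \<bullet> M u)"
    using norm_image_bound by blast
  then show "M u = 0" if "u \<bullet> M u = 0"
    using that by simp
qed simp

text \<open>On the orthogonal complement of the kernel \<open>M\<close> is injective, hence bounded
  below by \<open>e * norm p\<close>; the second part of \<open>norm_image_bound\<close> turns this
  into a bound on the form.\<close>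

lemma coercive:
  "\<exists>\<kappa>>0. \<forall>p. (\<forall>q. M q = 0 \<longrightarrow> p \<bullet> q = 0) \<longrightarrow> \<kappa> * (norm p)\<^sup>2 \<le> p \<bullet> M p"
proof -
  obtain B where B: "0 < B" "\<And>u. (norm (M u))\<^sup>2 \<le> B * (u \<bullet> M u)"
    using norm_image_bound by blast
  define S where "S = {p. \<forall>q. M q = 0 \<longrightarrow> p \<bullet> q = 0}"
  have sub: "subspace S"
    by (auto simp: S_def subspace_def inner_add_left)
  have "p = 0" if "p \<in> S" "M p = 0" for p
  proof -
    have "p \<bullet> p = 0"
      using that by (simp add: S_def)
    then show ?thesis
      by simp
  qed
  then obtain e where e: "0 < e" "\<And>p. p \<in> S \<Longrightarrow> e * norm p \<le> norm (M p)"
    using injective_imp_isometric[OF closed_subspace[OF sub] sub linear[unfolded linear_conv_bounded_linear]]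
    by auto
  show ?thesis
  proof (intro exI[of _ "e\<^sup>2 / B"] conjI allI impI)
    show "0 < e\<^sup>2 / B"
      using e(1) B(1) by simp
    fix p assume "\<forall>q. M q = 0 \<longrightarrow> p \<bullet> q = 0"
    then have "e * norm p \<le> norm (M p)"
      by (intro e(2)) (simp add: S_def)
    then have "(e * norm p)\<^sup>2 \<le> (norm (M p))\<^sup>2"
      using e(1) by (intro power_mono) auto
    then show "e\<^sup>2 / B * (norm p)\<^sup>2 \<le> p \<bullet> M p"
      using B(2)[of p] B(1) by (simp add: field_simps power_mult_distrib)
  qed
qed

lemma kernel_decomposition:
  "\<exists>p q. u = p + q \<and> M q = 0 \<and> (\<forall>q. M q = 0 \<longrightarrow> p \<bullet> q = 0)"
proof (rule orthogonal_subspace_decomp_exists[of "{q. M q = 0}" u])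
  fix q p
  assume "q \<in> span {q. M q = 0}" "\<And>w. w \<in> span {q. M q = 0} \<Longrightarrow> orthogonal p w" "u = q + p"
  moreover have "span {q. M q = 0} = {q. M q = 0}"
    by (simp only: span_eq_iff linear_subspace_kernel[OF linear])
  ultimately show ?thesis
    by - (rule exI[of _ p], rule exI[of _ q], simp add: orthogonal_def add.commute)
qed

text \<open>For the error bounds, \<open>z = a + p + q\<close> is near a minimiser: \<open>a\<close> is the solution of
  \<open>M a = - b\<close> of least norm, \<open>q\<close> the component of \<open>z\<close> in the kernel, and \<open>g\<close> the part of the
  gradient \<open>M p = M z + b\<close> of the Lagrangian that is not a multiple of \<open>z\<close>.\<close>

definition residual :: "'a \<Rightarrow> 'a \<Rightarrow> 'a \<Rightarrow> 'a \<Rightarrow> real \<Rightarrow> bool" where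
  "residual a p q g s \<longleftrightarrow>
     M q = 0 \<and> a \<bullet> q = 0 \<and> (\<forall>q. M q = 0 \<longrightarrow> p \<bullet> q = 0) \<and> M p = g + s *\<^sub>R (a + p + q) \<and>
     norm (a + p + q) \<le> 1 \<and> (s = 0 \<or> norm (a + p + q) = 1)"

text \<open>Since \<open>a\<close> is strictly inside the ball, a point \<open>a + p + q\<close> of
  the sphere with small \<open>p\<close> has a kernel component \<open>q\<close> bounded away from
  0. Pairing the equation for \<open>M p\<close> with \<open>q\<close> removes \<open>M p\<close>
  and bounds \<open>s\<close> by a multiple of \<open>norm g\<close>; coercivity then bounds
  \<open>p\<close>.\<close>

lemma linear_error_bound_interior:
  assumes a: "norm a < 1"
  shows "\<exists>\<delta>>0. \<exists>C\<ge>0. \<forall>p q g s. residual a p q g s \<and> norm p \<le> \<delta> \<longrightarrow> norm p \<le> C * norm g"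
proof -
  obtain \<kappa> where \<kappa>: "0 < \<kappa>"
    "\<And>p. \<forall>q. M q = 0 \<longrightarrow> p \<bullet> q = 0 \<Longrightarrow> \<kappa> * (norm p)\<^sup>2 \<le> p \<bullet> M p"
    using coercive by blast
  \<comment> \<open>By Pythagoras a lower bound for \<open>norm q\<close> on the sphere, given
    \<open>norm (a + p) \<le> (1 + norm a) / 2\<close>, which
    \<open>norm p \<le> (1 - norm a) / 2\<close> guarantees.\<close>
  define \<rho> where "\<rho> = sqrt (1 - ((1 + norm a) / 2)\<^sup>2)"
  have "((1 + norm a) / 2)\<^sup>2 < 1"
    using a by (simp add: abs_square_less_1)
  then have \<rho>: "0 < \<rho>" "\<rho>\<^sup>2 = 1 - ((1 + norm a) / 2)\<^sup>2"
    by (auto simp: \<rho>_def)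
  have main: "norm p \<le> (1 + 1 / \<rho>) / \<kappa> * norm g"
    if "residual a p q g s" and small: "norm p \<le> (1 - norm a) / 2" for p q g s
  proof -
    define z where "z = a + p + q"
    from \<open>residual a p q g s\<close> have q: "M q = 0" "a \<bullet> q = 0" and p: "\<And>q. M q = 0 \<Longrightarrow> p \<bullet> q = 0"
      and Mp: "M p = g + s *\<^sub>R z" and z1: "norm z \<le> 1" and s: "s = 0 \<or> norm z = 1"
      by (simp_all add: residual_def z_def)
    have qz: "q \<bullet> z = (norm q)\<^sup>2"
      using q p[of q] by (simp add: z_def inner_add_right inner_commute power2_norm_eq_inner)
    have s_le: "\<bar>s\<bar> \<le> norm g / \<rho>"
    proof (cases "s = 0")
      case False
      then have "norm z = 1"
        using s by blast
      have "norm (a + p) \<le> (1 + norm a) / 2"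
        using norm_triangle_ineq[of a p] small by (simp add: field_simps)
      then have "(norm (a + p))\<^sup>2 \<le> ((1 + norm a) / 2)\<^sup>2"
        by (intro power_mono) auto
      moreover have "(norm z)\<^sup>2 = (norm (a + p))\<^sup>2 + (norm q)\<^sup>2"
        using q(2) p[OF q(1)] unfolding z_def
        by (simp add: power2_norm_eq_inner inner_add_left inner_add_right inner_commute)
      ultimately have "\<rho>\<^sup>2 \<le> (norm q)\<^sup>2"
        unfolding \<open>norm z = 1\<close> \<rho>(2) one_power2 by linarith
      then have "\<rho> \<le> norm q"
        by (rule power2_le_imp_le) simp
      have "0 = q \<bullet> M p"
        using self_adjoint[of q p] q(1) by simp
      also have "\<dots> = q \<bullet> g + s * (norm q)\<^sup>2"
        by (simp add: Mp inner_add_right qz)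
      finally have "\<bar>s * (norm q)\<^sup>2\<bar> = \<bar>q \<bullet> g\<bar>"
        by linarith
      then have "\<bar>s\<bar> * (norm q)\<^sup>2 = \<bar>q \<bullet> g\<bar>"
        by (simp add: abs_mult)
      also have "\<dots> \<le> norm q * norm g"
        by (rule Cauchy_Schwarz_ineq2)
      finally have "(\<bar>s\<bar> * norm q) * norm q \<le> norm g * norm q"
        by (simp add: power2_eq_square mult_ac)
      then have "\<bar>s\<bar> * norm q \<le> norm g"
        by (rule mult_right_le_imp_le) (use \<open>\<rho> \<le> norm q\<close> \<rho>(1) in linarith)
      moreover have "\<bar>s\<bar> * \<rho> \<le> \<bar>s\<bar> * norm q"
        using \<open>\<rho> \<le> norm q\<close> by (intro mult_left_mono) auto
      ultimately show ?thesis
        using \<rho>(1) by (simp add: field_simps)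
    qed (use \<rho>(1) in simp)
    have "\<kappa> * (norm p)\<^sup>2 \<le> p \<bullet> M p"
      using \<kappa>(2) p by blast
    also have "\<dots> = p \<bullet> g + s * (p \<bullet> z)"
      by (simp add: Mp inner_add_right)
    also have "\<dots> \<le> norm p * norm g + (norm g / \<rho>) * norm p"
    proof (rule add_mono)
      show "p \<bullet> g \<le> norm p * norm g"
        by (rule norm_cauchy_schwarz)
      have "\<bar>p \<bullet> z\<bar> \<le> norm p * norm z"
        by (rule Cauchy_Schwarz_ineq2)
      also have "\<dots> \<le> norm p"
        using z1 by (simp add: mult_left_le)
      finally have "\<bar>s\<bar> * \<bar>p \<bullet> z\<bar> \<le> (norm g / \<rho>) * norm p"
        using s_le by (intro mult_mono) auto
      then show "s * (p \<bullet> z) \<le> (norm g / \<rho>) * norm p"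
        by (metis abs_ge_self abs_mult order_trans)
    qed
    finally have "\<kappa> * norm p * norm p \<le> ((1 + 1 / \<rho>) * norm g) * norm p"
      by (simp add: power2_eq_square algebra_simps)
    then have "\<kappa> * norm p \<le> (1 + 1 / \<rho>) * norm g" if "p \<noteq> 0"
      by (rule mult_right_le_imp_le) (use that in simp)
    then show ?thesis
      using \<kappa>(1) \<rho>(1) by (cases "p = 0") (simp_all add: field_simps)
  qed
  have "0 < (1 - norm a) / 2" "0 \<le> (1 + 1 / \<rho>) / \<kappa>"
    using a \<rho>(1) \<kappa>(1) by auto
  with main show ?thesis
    by - (rule exI[of _ "(1 - norm a) / 2"], rule conjI, assumption, rule exI[of _ "(1 + 1 / \<rho>) / \<kappa>"], blast)
qed

text \<open>With \<open>a\<close> on the sphere, a nonzero \<open>q\<close> alone would leave the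
  ball, so it must be compensated by \<open>p\<close>; this bounds \<open>q\<close>. Since
  \<open>q\<close> may now be small, \<open>s\<close> cannot be bounded by dividing by
  \<open>norm q\<close>; instead \<open>s * (p \<bullet> z)\<close> is split into a part absorbed by
  coercivity and a part controlled by pairing with \<open>q\<close>.\<close>

lemma error_bound_boundary_aux:
  assumes a: "norm a = 1"
  shows "\<exists>\<delta>>0. \<exists>\<kappa>>0. \<delta> \<le> 1 \<and> (\<forall>p q g s. residual a p q g s \<and> norm p \<le> \<delta> \<longrightarrow>
      \<kappa> * (norm p)\<^sup>2 \<le> 3 * norm p * norm g + norm q * norm g \<and> (norm q)\<^sup>2 \<le> 2 * norm p)"
proof -
  obtain \<kappa> where \<kappa>: "0 < \<kappa>"
    "\<And>p. \<forall>q. M q = 0 \<longrightarrow> p \<bullet> q = 0 \<Longrightarrow> \<kappa> * (norm p)\<^sup>2 \<le> p \<bullet> M p"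
    using coercive by blast
  obtain B where B: "0 < B" "\<And>u. norm (M u) \<le> B * norm u"
    using norm_image_bound by blast
  have main: "\<kappa> * (norm p)\<^sup>2 \<le> 3 * norm p * norm g + norm q * norm g \<and> (norm q)\<^sup>2 \<le> 2 * norm p"
    if "residual a p q g s" "norm p \<le> min 1 (\<kappa> / B)" for p q g s
  proof -
    define z where "z = a + p + q"
    from that have q: "M q = 0" "a \<bullet> q = 0" and p: "\<And>q. M q = 0 \<Longrightarrow> p \<bullet> q = 0"
      and Mp: "M p = g + s *\<^sub>R z" and z1: "norm z \<le> 1" and s: "s = 0 \<or> norm z = 1"
      and "norm p \<le> 1" "norm p \<le> \<kappa> / B"
      by (simp_all add: residual_def z_def)
    then have small: "norm p \<le> 1" "B * norm p \<le> \<kappa>"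
      using B(1) by (simp_all add: field_simps)
    have norm_z: "(norm z)\<^sup>2 = 1 + 2 * (p \<bullet> a) + (norm p)\<^sup>2 + (norm q)\<^sup>2"
      using q(2) p[OF q(1)] a unfolding z_def
      by (simp add: power2_norm_eq_inner inner_add_left inner_add_right inner_commute norm_eq_1)
    have "(norm z)\<^sup>2 \<le> 1"
      using z1 by (simp add: abs_square_le_1)
    moreover have "\<bar>p \<bullet> a\<bar> \<le> norm p"
      using Cauchy_Schwarz_ineq2[of p a] a by simp
    ultimately have q_le: "(norm q)\<^sup>2 \<le> 2 * norm p"
      using norm_z zero_le_power2[of "norm p"] by linarith
    have pg: "p \<bullet> g \<le> norm p * norm g"
      by (rule norm_cauchy_schwarz)
    have kp: "\<kappa> * (norm p)\<^sup>2 \<le> p \<bullet> g + s * (p \<bullet> z)"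
      using \<kappa>(2)[of p] p by (simp add: Mp inner_add_right)
    have "\<kappa> * (norm p)\<^sup>2 \<le> 3 * norm p * norm g + norm q * norm g"
    proof (cases "s = 0")
      case True
      then show ?thesis
        using kp pg mult_nonneg_nonneg[OF norm_ge_zero norm_ge_zero, of q g]
          mult_nonneg_nonneg[OF norm_ge_zero norm_ge_zero, of p g]
        unfolding True by linarith
    next
      case False
      then have nz: "norm z = 1"
        using s by blast
      have "p \<bullet> q = 0"
        using p q by blast
      \<comment> \<open>On the sphere
        \<open>2 * (p \<bullet> a) = - (norm p)\<^sup>2 - (norm q)\<^sup>2\<close>; this eliminates
        \<open>a\<close> and leaves the term \<open>s * (norm q)\<^sup>2\<close> that pairing with
        \<open>q\<close> controls.\<close>
      then have pz: "p \<bullet> z = ((norm p)\<^sup>2 - (norm q)\<^sup>2) / 2"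
        using norm_z nz inner_add_right[of p "a + p" q] inner_add_right[of p a p]
        unfolding z_def[symmetric] power2_norm_eq_inner[of p] by simp
      have "s = z \<bullet> M p - z \<bullet> g"
        using nz by (simp add: Mp inner_add_right norm_eq_1)
      moreover have "\<bar>z \<bullet> M p\<bar> \<le> B * norm p"
        using Cauchy_Schwarz_ineq2[of z "M p"] B(2)[of p] nz by simp
      moreover have "\<bar>z \<bullet> g\<bar> \<le> norm g"
        using Cauchy_Schwarz_ineq2[of z g] nz by simp
      \<comment> \<open>The radius \<open>\<kappa> / B\<close> is chosen for this bound: half of the
        coercivity term then survives the absorption of
        \<open>s * (norm p)\<^sup>2 / 2\<close>.\<close>
      ultimately have s_le: "\<bar>s\<bar> \<le> \<kappa> + norm g"
        using small by linarith
      have qz: "q \<bullet> z = (norm q)\<^sup>2"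
        using q \<open>p \<bullet> q = 0\<close> by (simp add: z_def inner_add_right inner_commute power2_norm_eq_inner)
      have "0 = q \<bullet> M p"
        using self_adjoint[of q p] q(1) by simp
      also have "\<dots> = q \<bullet> g + s * (norm q)\<^sup>2"
        by (simp add: Mp inner_add_right qz)
      finally have sq: "- s * (norm q)\<^sup>2 \<le> norm q * norm g"
        using norm_cauchy_schwarz[of q g] by linarith
      have "s * (norm p)\<^sup>2 \<le> (\<kappa> + norm g) * (norm p)\<^sup>2"
        using s_le by (intro mult_right_mono) auto
      moreover have "norm g * (norm p)\<^sup>2 \<le> norm p * norm g"
        using mult_right_mono[OF small(1), of "norm p * norm g"]
        by (simp add: power2_eq_square mult_ac)
      ultimately have "s * (p \<bullet> z) \<le> \<kappa> * (norm p)\<^sup>2 / 2 + norm p * norm g / 2 + norm q * norm g / 2"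
        using sq unfolding pz by (simp add: algebra_simps)
      then show ?thesis
        using kp pg by (simp add: algebra_simps)
    qed
    with q_le show ?thesis
      by blast
  qed
  have "0 < min 1 (\<kappa> / B)" "min 1 (\<kappa> / B) \<le> 1"
    using \<kappa>(1) B(1) by auto
  with main \<kappa>(1) show ?thesis
    by - (rule exI[of _ "min 1 (\<kappa> / B)"], rule conjI, assumption, rule exI[of _ "\<kappa>"], blast)
qed

text \<open>With a trivial kernel \<open>q = 0\<close>, so the term that degrades the estimate
  disappears and a factor \<open>norm p\<close> cancels.\<close>

lemma linear_error_bound_injective:
  assumes a: "norm a = 1" and inj: "\<And>q. M q = 0 \<Longrightarrow> q = 0"
  shows "\<exists>\<delta>>0. \<exists>C\<ge>0. \<forall>p q g s. residual a p q g s \<and> norm p \<le> \<delta> \<longrightarrow> norm p \<le> C * norm g"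
proof -
  obtain \<delta> \<kappa> where *: "0 < \<delta>" "\<delta> \<le> 1" "0 < \<kappa>"
    "\<And>p q g s. residual a p q g s \<and> norm p \<le> \<delta>
      \<Longrightarrow> \<kappa> * (norm p)\<^sup>2 \<le> 3 * norm p * norm g + norm q * norm g \<and> (norm q)\<^sup>2 \<le> 2 * norm p"
    using error_bound_boundary_aux[OF a] by blast
  have main: "norm p \<le> 3 / \<kappa> * norm g" if A: "residual a p q g s" "norm p \<le> \<delta>" for p q g s
  proof -
    have "\<kappa> * (norm p)\<^sup>2 \<le> 3 * norm p * norm g"
      using *(4)[of p q g s] A inj[of q] by (simp add: residual_def)
    then have "(\<kappa> * norm p) * norm p \<le> (3 * norm g) * norm p"
      by (simp add: power2_eq_square mult_ac)
    then have "\<kappa> * norm p \<le> 3 * norm g" if "p \<noteq> 0"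
      by (rule mult_right_le_imp_le) (use that in simp)
    then show ?thesis
      using *(3) by (cases "p = 0") (simp_all add: field_simps)
  qed
  have "0 \<le> 3 / \<kappa>"
    using *(3) by simp
  with *(1) main show ?thesis
    by - (rule exI[of _ "\<delta>"], rule conjI, assumption, rule exI[of _ "3 / \<kappa>"], blast)
qed

text \<open>The kernel component is only of order \<open>sqrt (norm p)\<close>, so with
  \<open>t = sqrt (norm p)\<close> the auxiliary estimate becomes
  \<open>\<kappa> * t ^ 4 \<le> 5 * t * norm g\<close>. This loss against the linear bounds is the
  source of the sublinear rate.\<close>

lemma cubic_error_bound:
  assumes a: "norm a = 1"
  shows "\<exists>\<delta>>0. \<exists>C\<ge>0. \<forall>p q g s. residual a p q g s \<and> norm p \<le> \<delta> \<longrightarrow> norm p ^ 3 \<le> C * (norm g)\<^sup>2"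
proof -
  obtain \<delta> \<kappa> where *: "0 < \<delta>" "\<delta> \<le> 1" "0 < \<kappa>"
    "\<And>p q g s. residual a p q g s \<and> norm p \<le> \<delta>
      \<Longrightarrow> \<kappa> * (norm p)\<^sup>2 \<le> 3 * norm p * norm g + norm q * norm g \<and> (norm q)\<^sup>2 \<le> 2 * norm p"
    using error_bound_boundary_aux[OF a] by blast
  have main: "norm p ^ 3 \<le> (5 / \<kappa>)\<^sup>2 * (norm g)\<^sup>2" if A: "residual a p q g s" "norm p \<le> \<delta>" for p q g s
  proof -
    define t where "t = sqrt (norm p)"
    have t: "0 \<le> t" "t \<le> 1" "norm p = t\<^sup>2"
      using A(2) *(2) by (auto simp: t_def)
    have bound: "\<kappa> * (norm p)\<^sup>2 \<le> 3 * norm p * norm g + norm q * norm g" "(norm q)\<^sup>2 \<le> 2 * norm p"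
      using *(4)[of p q g s] A by simp_all
    have "(norm q)\<^sup>2 \<le> 4 * t\<^sup>2"
      using bound(2) t(3) zero_le_power2[of t] by linarith
    then have "(norm q)\<^sup>2 \<le> (2 * t)\<^sup>2"
      by (simp add: power_mult_distrib)
    then have "norm q \<le> 2 * t"
      by (rule power2_le_imp_le) (use t in simp)
    moreover have "norm p \<le> t"
      using t by (simp add: power2_eq_square mult_left_le)
    ultimately have "3 * norm p * norm g + norm q * norm g \<le> 5 * t * norm g"
      using mult_right_mono[of "3 * norm p + norm q" "5 * t" "norm g"]
      by (simp add: algebra_simps)
    then have "\<kappa> * (norm p)\<^sup>2 \<le> 5 * t * norm g"
      using bound(1) by linarith
    then have "(\<kappa> * t ^ 3) * t \<le> (5 * norm g) * t"
      unfolding t(3) by (simp add: power2_eq_square power3_eq_cube mult_ac)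
    then have "\<kappa> * t ^ 3 \<le> 5 * norm g" if "t \<noteq> 0"
      by (rule mult_right_le_imp_le) (use that t(1) in simp)
    then have "t ^ 3 \<le> 5 / \<kappa> * norm g"
      using *(3) by (cases "t = 0") (simp_all add: field_simps)
    then have "(t ^ 3)\<^sup>2 \<le> (5 / \<kappa> * norm g)\<^sup>2"
      using t(1) by (intro power_mono) auto
    also have "\<dots> = (5 / \<kappa>)\<^sup>2 * (norm g)\<^sup>2"
      by (rule power_mult_distrib)
    finally show ?thesis
      unfolding t(3) by (simp flip: power_mult)
  qed
  have "0 \<le> (5 / \<kappa>)\<^sup>2"
    using *(3) by simp
  with *(1) main show ?thesis
    by - (rule exI[of _ "\<delta>"], rule conjI, assumption, rule exI[of _ "(5 / \<kappa>)\<^sup>2"], blast)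
qed

end

section \<open>Rates from recurrences\<close>

text \<open>Discrete counterpart of the differential inequality
  \<open>h' \<le> - h\<^sup>2 / (2 * c)\<close>, whose solutions decay like
  \<open>2 * c / k\<close>.\<close>

lemma inverse_linear_rate:
  fixes h :: "nat \<Rightarrow> real"
  assumes K: "1 \<le> K" and c: "0 \<le> c" and nonneg: "\<And>k. 0 \<le> h k"
    and rec: "\<And>k. K \<le> k \<Longrightarrow> h (Suc k) ^ 3 \<le> c * ((h k)\<^sup>2 - (h (Suc k))\<^sup>2)"
  shows "\<exists>B\<ge>0. \<forall>k\<ge>K. h k \<le> B / real k"
proof -
  \<comment> \<open>The second entry starts the induction at \<open>K\<close>; the first closes its
    step, through \<open>(2 * n + 1) * (n + 1) \<le> 6 * n\<^sup>2\<close> for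
    \<open>n \<ge> 1\<close>.\<close>
  define B where "B = max (6 * c) (real K * h K)"
  have B: "0 \<le> B" "6 * c \<le> B" "real K * h K \<le> B"
    using c by (auto simp: B_def)
  have "h k \<le> B / real k" if "K \<le> k" for k
    using that
  proof (induction k rule: dec_induct)
    case base
    then show ?case
      using B(3) K by (simp add: field_simps)
  next
    case (step k)
    define n where "n = real k"
    have n: "1 \<le> n"
      using step(1) K by (simp add: n_def)
    show ?case
    proof (rule ccontr)
      assume "\<not> ?thesis"
      then have gt: "B / (n + 1) < h (Suc k)"
        by (simp add: n_def add.commute)
      have pos: "0 \<le> B / (n + 1)"
        using B(1) n by simp
      have "(B / (n + 1)) ^ 3 < h (Suc k) ^ 3"
        using gt pos by (intro power_strict_mono) auto
      also have "\<dots> \<le> c * ((h k)\<^sup>2 - (h (Suc k))\<^sup>2)"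
        using rec step(1) by blast
      also have "\<dots> \<le> c * ((B / n)\<^sup>2 - (B / (n + 1))\<^sup>2)"
      proof (intro mult_left_mono diff_mono)
        show "(h k)\<^sup>2 \<le> (B / n)\<^sup>2"
          using step(3) nonneg by (intro power_mono) (auto simp: n_def)
        show "(B / (n + 1))\<^sup>2 \<le> (h (Suc k))\<^sup>2"
          using gt pos by (intro power_mono) auto
      qed (rule c)
      also have "\<dots> = (B\<^sup>2 / (n\<^sup>2 * (n + 1) ^ 3)) * (c * ((2 * n + 1) * (n + 1)))"
        using n by (simp add: divide_simps power2_eq_square power3_eq_cube) algebra
      also have "\<dots> \<le> (B\<^sup>2 / (n\<^sup>2 * (n + 1) ^ 3)) * (B * n\<^sup>2)"
      proof (rule mult_left_mono)
        have "(2 * n + 1) * (n + 1) \<le> (3 * n) * (2 * n)"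
          using n by (intro mult_mono) auto
        then have "c * ((2 * n + 1) * (n + 1)) \<le> c * (6 * n\<^sup>2)"
          using c by (intro mult_left_mono) (auto simp: power2_eq_square)
        also have "\<dots> = (6 * c) * n\<^sup>2"
          by simp
        also have "\<dots> \<le> B * n\<^sup>2"
          using B(2) by (intro mult_right_mono) auto
        finally show "c * ((2 * n + 1) * (n + 1)) \<le> B * n\<^sup>2" .
      qed (use n in simp)
      also have "\<dots> = (B / (n + 1)) ^ 3"
        using n by (simp add: power_divide power2_eq_square power3_eq_cube mult_ac)
      finally show False
        by simp
    qed
  qed
  then show ?thesis
    using B(1) by blast
qed

text \<open>The concave reparametrisation \<open>a = G\<^bsup>1/4\<^esup>\<close> of the objective gap turns step lengths into
  telescoping differences.\<close>

lemma step_le_telescoping: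
  fixes a a' d \<alpha> c A :: real
  assumes nonneg: "0 \<le> a" "0 \<le> a'" "0 \<le> d" "0 \<le> c" and A: "a \<le> A" and \<alpha>: "0 < \<alpha>"
    and decrease: "\<alpha> * d\<^sup>2 \<le> a ^ 4 - a' ^ 4" and error: "a' ^ 3 \<le> c * d"
  shows "d \<le> (15 * c / \<alpha> + 2 * A / sqrt \<alpha>) * (a - a')"
proof -
  have "a' ^ 4 \<le> a ^ 4"
    using decrease \<alpha> mult_nonneg_nonneg[OF less_imp_le[OF \<alpha>] zero_le_power2, of d] by linarith
  then have a': "a' \<le> a"
    using nonneg(1) by (rule power_le_imp_le_base[of _ 3, simplified])
  show ?thesis
  \<comment> \<open>If \<open>a'\<close> is comparable to \<open>a\<close>, then
    \<open>a ^ 4 - a' ^ 4\<close> is at most \<open>15 * a' ^ 3 * (a - a')\<close> and the error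
    bound trades \<open>a' ^ 3\<close> for \<open>d\<close>. Otherwise \<open>a\<close> is below
    \<open>2 * (a - a')\<close> and the decrease alone suffices.\<close>
  proof (cases "a \<le> 2 * a'")
    case True
    have "a ^ 4 - a' ^ 4 = ((a + a') * (a\<^sup>2 + a'\<^sup>2)) * (a - a')"
      by (simp add: power2_eq_square power4_eq_xxxx algebra_simps)
    also have "\<dots> \<le> (3 * a' * (5 * a'\<^sup>2)) * (a - a')"
    proof (intro mult_right_mono mult_mono)
      have "a\<^sup>2 \<le> (2 * a')\<^sup>2"
        using True nonneg by (intro power_mono) auto
      then show "a\<^sup>2 + a'\<^sup>2 \<le> 5 * a'\<^sup>2"
        by (simp add: power_mult_distrib)
    qed (use True nonneg a' in auto)
    also have "\<dots> = 15 * a' ^ 3 * (a - a')"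
      by (simp add: power2_eq_square power3_eq_cube)
    also have "\<dots> \<le> 15 * (c * d) * (a - a')"
      using error a' by (intro mult_right_mono) auto
    finally have "(\<alpha> * d) * d \<le> (15 * c * (a - a')) * d"
      using decrease by (simp add: power2_eq_square mult_ac)
    then have "\<alpha> * d \<le> 15 * c * (a - a')" if "0 < d"
      by (rule mult_right_le_imp_le) (use that in simp)
    then have "d \<le> 15 * c / \<alpha> * (a - a')"
      using \<alpha> nonneg a' by (cases "d = 0") (auto simp: field_simps intro: mult_right_mono)
    moreover have "0 \<le> 2 * A / sqrt \<alpha> * (a - a')"
      using A nonneg \<alpha> a' by (intro mult_nonneg_nonneg) auto
    ultimately show ?thesis
      by (simp add: distrib_right)
  next
    case False
    have "(sqrt \<alpha> * d)\<^sup>2 \<le> (a\<^sup>2)\<^sup>2"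
    proof -
      have "(sqrt \<alpha> * d)\<^sup>2 = \<alpha> * d\<^sup>2"
        using \<alpha> by (simp add: power_mult_distrib)
      also have "\<dots> \<le> a ^ 4"
        using decrease nonneg by (smt (verit) zero_le_power)
      finally show ?thesis
        by (simp flip: power_mult)
    qed
    then have "sqrt \<alpha> * d \<le> a\<^sup>2"
      by (rule power2_le_imp_le) simp
    also have "\<dots> \<le> A * a"
      using A nonneg by (simp add: power2_eq_square mult_right_mono)
    also have "\<dots> \<le> A * (2 * (a - a'))"
      using A nonneg False by (intro mult_left_mono) auto
    finally have "d \<le> 2 * A / sqrt \<alpha> * (a - a')"
      using \<alpha> by (simp add: field_simps)
    moreover have "0 \<le> 15 * c / \<alpha> * (a - a')"
      using nonneg \<alpha> a' by (intro mult_nonneg_nonneg) auto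
    ultimately show ?thesis
      by (simp add: distrib_right)
  qed
qed

lemma convergent_if_telescoping_steps:
  fixes z :: "nat \<Rightarrow> 'a::banach" and a :: "nat \<Rightarrow> real"
  assumes steps: "\<forall>\<^sub>F k in sequentially. norm (z (Suc k) - z k) \<le> C * (a k - a (Suc k))"
    and a: "convergent a"
  shows "convergent z"
proof -
  obtain l where "a \<longlonglongrightarrow> l"
    using a by (auto simp: convergent_def)
  then have "summable (\<lambda>k. C * (a k - a (Suc k)))"
    by (intro summable_mult telescope_summable')
  then have "summable (\<lambda>k. z (Suc k) - z k)"
    by (rule summable_comparison_test_ev[OF steps])
  then have "convergent (\<lambda>n. \<Sum>k<n. z (Suc k) - z k)"
    by (simp add: summable_iff_convergent)
  then have "convergent (\<lambda>n. z n - z 0)"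
    by (simp add: sum_lessThan_telescope)
  then show ?thesis
    by (simp add: convergent_diff_const_right_iff)
qed

lemma geometric_rate:
  fixes G :: "nat \<Rightarrow> real"
  assumes c: "0 < c" and nonneg: "\<And>k. 0 \<le> G k"
    and rec: "\<And>k. K \<le> k \<Longrightarrow> G (Suc k) \<le> c * (G k - G (Suc k))"
  shows "\<exists>C \<rho>. 0 \<le> C \<and> 0 < \<rho> \<and> \<rho> < 1 \<and> (\<forall>k\<ge>K. G k \<le> C * \<rho> ^ k)"
proof -
  \<comment> \<open>The contraction factor obtained by solving the recurrence for
    \<open>G (Suc k)\<close>.\<close>
  define \<rho> where "\<rho> = c / (1 + c)"
  have \<rho>: "0 < \<rho>" "\<rho> < 1"
    using c by (auto simp: \<rho>_def)
  have step: "G (Suc k) \<le> \<rho> * G k" if "K \<le> k" for k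
    using rec[OF that] c by (simp add: \<rho>_def field_simps)
  have "G k \<le> G K / \<rho> ^ K * \<rho> ^ k" if "K \<le> k" for k
    using that
  proof (induction k rule: dec_induct)
    case base
    then show ?case
      using \<rho> by simp
  next
    case (step k)
    have "G (Suc k) \<le> \<rho> * G k"
      using \<open>\<And>k. K \<le> k \<Longrightarrow> G (Suc k) \<le> \<rho> * G k\<close> step(1) by blast
    also have "\<dots> \<le> \<rho> * (G K / \<rho> ^ K * \<rho> ^ k)"
      using step(3) \<rho> by (intro mult_left_mono) auto
    finally show ?case
      by (simp add: mult_ac)
  qed
  moreover have "0 \<le> G K / \<rho> ^ K"
    using nonneg \<rho> by simp
  ultimately show ?thesis
    using \<rho> by blast
qed

section \<open>Quadratic functions on the unit ball\<close>

locale quadratic =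
  fixes T :: "'a::euclidean_space \<Rightarrow> 'a" and b :: 'a
  assumes linear: "linear T"
    and self_adjoint: "\<And>u v. u \<bullet> T v = T u \<bullet> v"
begin

definition obj :: "'a \<Rightarrow> real" where
  "obj z = 1 / 2 * (z \<bullet> T z) + b \<bullet> z"

text \<open>Semidefiniteness of the shifted operator is asked on the whole space, not only on
  tangent directions; this makes the condition a certificate of global minimality although
  \<open>obj\<close> need not be convex.\<close>

definition kkt :: "'a \<Rightarrow> real \<Rightarrow> bool" where
  "kkt z l \<longleftrightarrow> T z + l *\<^sub>R z + b = 0 \<and> 0 \<le> l \<and> l * (z \<bullet> z - 1) = 0 \<and> z \<bullet> z \<le> 1 \<and>
     (\<forall>u. 0 \<le> u \<bullet> T u + l * (u \<bullet> u))"

lemma continuous_T: "continuous_on UNIV T"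
  using linear by (intro linear_continuous_on) (simp add: linear_conv_bounded_linear)

lemma tendsto_T: "(f \<longlongrightarrow> y) F \<Longrightarrow> ((\<lambda>k. T (f k)) \<longlongrightarrow> T y) F"
  using continuous_T by (intro continuous_on_tendsto_compose[of UNIV T]) auto

lemma tendsto_obj: "(f \<longlongrightarrow> y) F \<Longrightarrow> ((\<lambda>k. obj (f k)) \<longlongrightarrow> obj y) F"
  unfolding obj_def by (intro tendsto_intros tendsto_T)

lemma obj_add: "obj (z + d) = obj z + (T z + b) \<bullet> d + 1 / 2 * (d \<bullet> T d)"
  using self_adjoint[of z d] self_adjoint[of d z]
  by (simp add: obj_def linear_add[OF linear] inner_add_left inner_add_right inner_commute
      algebra_simps)

text \<open>The gradient at \<open>z\<close> is \<open>- (l *\<^sub>R z)\<close>, and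
  \<open>l * (z \<bullet> z) = l\<close> lets the resulting linear term be completed to a square.
  The gap is an exact sum of a curvature and a slack term, both nonnegative on the ball.\<close>

lemma kkt_gap:
  assumes "kkt z l"
  shows "obj w - obj z
    = 1 / 2 * ((w - z) \<bullet> (T (w - z) + l *\<^sub>R (w - z))) + l / 2 * (1 - w \<bullet> w)"
proof -
  have *: "T z + b = - (l *\<^sub>R z)" and "l * (z \<bullet> z) = l"
    using assms by (simp_all add: kkt_def eq_neg_iff_add_eq_0 algebra_simps)
  have "obj w - obj z = - (l *\<^sub>R z) \<bullet> (w - z) + 1 / 2 * ((w - z) \<bullet> T (w - z))"
    using obj_add[of z "w - z"] unfolding * by simp
  also have "- (l *\<^sub>R z) \<bullet> (w - z) = 1 / 2 * ((w - z) \<bullet> (l *\<^sub>R (w - z))) + l / 2 * (1 - w \<bullet> w)"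
    using \<open>l * (z \<bullet> z) = l\<close>
    by (simp add: inner_diff_left inner_diff_right inner_commute[of w z] field_simps)
  finally show ?thesis
    by (simp add: inner_add_right algebra_simps)
qed

lemma psd_operator_shift:
  assumes "kkt z l"
  shows "psd_operator (\<lambda>u. T u + l *\<^sub>R u)"
proof (rule psd_operator.intro)
  show "linear (\<lambda>u. T u + l *\<^sub>R u)"
    by (intro linear_compose_add linear linear_scaleR)
qed (use assms self_adjoint in \<open>auto simp: kkt_def inner_add_left inner_add_right\<close>)

lemma kkt_minimal:
  assumes "kkt z l" "w \<bullet> w \<le> 1"
  shows "obj z \<le> obj w"
proof -
  interpret psd_operator "\<lambda>u. T u + l *\<^sub>R u"
    by (rule psd_operator_shift[OF assms(1)])
  have "0 \<le> l / 2 * (1 - w \<bullet> w)"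
    using assms by (simp add: kkt_def)
  then show ?thesis
    using kkt_gap[OF assms(1), of w] nonneg[of "w - z"] by linarith
qed

text \<open>Both terms of \<open>kkt_gap\<close> must vanish, so \<open>w - z\<close> lies in the
  kernel of the shifted operator. That all minimisers share one multiplier serves both the limit of
  the iterates and the uniqueness of \<open>trs_multiplier\<close>.\<close>

lemma kkt_of_obj_eq:
  assumes "kkt z l" "w \<bullet> w \<le> 1" "obj w = obj z"
  shows "kkt w l"
proof -
  interpret psd_operator "\<lambda>u. T u + l *\<^sub>R u"
    by (rule psd_operator_shift[OF assms(1)])
  have "0 \<le> l / 2 * (1 - w \<bullet> w)"
    using assms by (simp add: kkt_def)
  then have zero: "(w - z) \<bullet> (T (w - z) + l *\<^sub>R (w - z)) = 0" "l / 2 * (1 - w \<bullet> w) = 0"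
    using kkt_gap[OF assms(1), of w] nonneg[of "w - z"] assms(3) by linarith+
  from zero(1) have "T (w - z) + l *\<^sub>R (w - z) = 0"
    by (simp only: kernel_iff)
  then have "T w + l *\<^sub>R w + b = T z + l *\<^sub>R z + b"
    by (simp add: linear_diff[OF quadratic.linear[OF quadratic_axioms]] algebra_simps)
  then show ?thesis
    using assms zero(2) by (auto simp: kkt_def)
qed

end

section \<open>Projected gradient descent on the unit ball\<close>

text \<open>The iteration is multiplied out by the normalising factor \<open>m k\<close>, so that in
  the limit \<open>(m k - 1) / \<eta>\<close> can be read off as the multiplier.\<close>

locale projected_gradient = quadratic T b
  for T :: "'a::euclidean_space \<Rightarrow> 'a" and b +
  fixes \<eta> L :: real and m :: "nat \<Rightarrow> real" and z :: "nat \<Rightarrow> 'a"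
  assumes upper: "\<And>u. u \<bullet> T u \<le> L * (u \<bullet> u)"
    and step_pos: "0 < \<eta>"
    and step_bound: "\<eta> * L < 2"
    and start: "norm (z 0) \<le> 1"
    and scale: "\<And>k. m k = max 1 (norm (z k - \<eta> *\<^sub>R (T (z k) + b)))"
    and iteration: "\<And>k. m k *\<^sub>R z (Suc k) = z k - \<eta> *\<^sub>R (T (z k) + b)"
begin

section \<open>Sufficient decrease and vanishing steps\<close>

lemma scale_ge_1: "1 \<le> m k"
  by (simp add: scale)

lemma scale_alt: "m k = max 1 (m k * norm (z (Suc k)))"
proof -
  have "norm (z k - \<eta> *\<^sub>R (T (z k) + b)) = m k * norm (z (Suc k))"
    using scale_ge_1[of k] by (simp flip: iteration)
  then show ?thesis
    using scale[of k] by simp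
qed

lemma norm_le_1: "norm (z k) \<le> 1"
proof (cases k)
  case (Suc j)
  have "m j * norm (z (Suc j)) \<le> m j * 1"
    using scale_alt[of j] by simp
  then show ?thesis
    using scale_ge_1[of j] Suc by simp
qed (use start in simp)

lemma inner_le_1: "z k \<bullet> z k \<le> 1"
  using norm_le_1[of k] by (simp add: norm_le_square)

lemma norm_eq_1_if_scaled:
  assumes "m k \<noteq> 1"
  shows "norm (z (Suc k)) = 1"
proof -
  have "m k = m k * norm (z (Suc k))"
    using assms scale_alt[of k] by (simp add: max_def split: if_splits)
  then show ?thesis
    using scale_ge_1[of k] by simp
qed

definition "dec = 1 / \<eta> - L / 2"

lemma dec_pos: "0 < dec"
  using step_pos step_bound by (simp add: dec_def field_simps)

text \<open>If the normalisation is active, \<open>z (Suc k)\<close> is a unit vector and maximises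
  the inner product with itself over the ball: the variational inequality of the projection. It
  bounds the directional derivative by \<open>- (d \<bullet> d) / \<eta>\<close>, and
  \<open>upper\<close> bounds the second-order term.\<close>

lemma descent: "dec * (norm (z (Suc k) - z k))\<^sup>2 \<le> obj (z k) - obj (z (Suc k))"
proof -
  define d where "d = z (Suc k) - z k"
  have "(m k - 1) * (z (Suc k) \<bullet> d) \<ge> 0"
  proof (cases "m k = 1")
    case False
    then have "norm (z (Suc k)) = 1"
      by (rule norm_eq_1_if_scaled)
    moreover have "z (Suc k) \<bullet> z k \<le> norm (z (Suc k)) * norm (z k)"
      by (rule norm_cauchy_schwarz)
    moreover have "z (Suc k) \<bullet> z (Suc k) = 1"
      using \<open>norm (z (Suc k)) = 1\<close> by (simp only: norm_eq_1)
    ultimately have "z (Suc k) \<bullet> d \<ge> 0"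
      using norm_le_1[of k] by (simp add: d_def inner_diff_right)
    then show ?thesis
      using scale_ge_1[of k] by simp
  qed simp
  also have "(m k - 1) * (z (Suc k) \<bullet> d) = (m k *\<^sub>R z (Suc k) - z (Suc k)) \<bullet> d"
    by (simp add: inner_diff_left algebra_simps)
  also have "m k *\<^sub>R z (Suc k) - z (Suc k) = - d - \<eta> *\<^sub>R (T (z k) + b)"
    by (simp add: iteration d_def)
  finally have "\<eta> * ((T (z k) + b) \<bullet> d) \<le> - (d \<bullet> d)"
    by (simp add: inner_diff_left)
  then have "(T (z k) + b) \<bullet> d \<le> - (d \<bullet> d) / \<eta>"
    using step_pos by (simp add: field_simps)
  moreover have "obj (z (Suc k)) = obj (z k) + (T (z k) + b) \<bullet> d + 1 / 2 * (d \<bullet> T d)"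
    using obj_add[of "z k" d] by (simp add: d_def)
  ultimately have "obj (z (Suc k)) \<le> obj (z k) - (d \<bullet> d) / \<eta> + L / 2 * (d \<bullet> d)"
    using upper[of d] by simp
  then show ?thesis
    by (simp add: dec_def d_def[symmetric] power2_norm_eq_inner left_diff_distrib)
qed

lemma obj_Suc_le: "obj (z (Suc k)) \<le> obj (z k)"
  using descent[of k] mult_nonneg_nonneg[OF less_imp_le[OF dec_pos] zero_le_power2, of "norm (z (Suc k) - z k)"]
  by linarith

lemma convergent_obj: "convergent (\<lambda>k. obj (z k))"
proof -
  have "continuous_on (cball 0 1) obj"
    unfolding continuous_on_def by (auto intro!: tendsto_obj)
  then have "compact (obj ` cball 0 1)"
    by (intro compact_continuous_image) auto
  then have "bounded (obj ` cball 0 1)"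
    by (rule compact_imp_bounded)
  then have "bounded (range (\<lambda>k. obj (z k)))"
    by (rule bounded_subset) (use norm_le_1 in auto)
  then have "Bseq (\<lambda>k. obj (z k))"
    by (simp add: Bseq_eq_bounded)
  moreover have "decseq (\<lambda>k. obj (z k))"
    using obj_Suc_le by (rule decseq_SucI)
  ultimately show ?thesis
    by (intro Bseq_monoseq_convergent) (simp_all add: monoseq_iff)
qed

lemma steps_tendsto_0: "(\<lambda>k. z (Suc k) - z k) \<longlonglongrightarrow> 0"
proof -
  obtain l where l: "(\<lambda>k. obj (z k)) \<longlonglongrightarrow> l"
    using convergent_obj by (auto simp: convergent_def)
  then have "(\<lambda>k. (obj (z k) - obj (z (Suc k))) / dec) \<longlonglongrightarrow> (l - l) / dec"
    using dec_pos by (intro tendsto_intros LIMSEQ_Suc) auto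
  then have lim: "(\<lambda>k. (obj (z k) - obj (z (Suc k))) / dec) \<longlonglongrightarrow> 0"
    by simp
  have "(\<lambda>k. (norm (z (Suc k) - z k))\<^sup>2) \<longlonglongrightarrow> 0"
    by (rule tendsto_sandwich[OF _ _ tendsto_const lim])
      (use descent dec_pos in \<open>simp_all add: field_simps\<close>)
  then have "(\<lambda>k. sqrt ((norm (z (Suc k) - z k))\<^sup>2)) \<longlonglongrightarrow> sqrt 0"
    by (rule tendsto_real_sqrt)
  then show ?thesis
    by (simp add: tendsto_norm_zero_iff)
qed

text \<open>Along an eigenvector \<open>e\<close> orthogonal to \<open>b\<close> the iteration multiplies the coordinate by
  \<open>(1 - \<eta> l) / m k\<close>; it stays bounded, so \<open>m k\<close> cannot stay below \<open>1 - \<eta> l\<close>.\<close>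

lemma scale_frequently_large:
  assumes e: "T e = l *\<^sub>R e" "e \<bullet> b = 0" "e \<bullet> z 0 \<noteq> 0" and \<epsilon>: "0 < \<epsilon>"
  shows "\<exists>k\<ge>N. 1 - \<eta> * l - \<epsilon> < m k"
proof (rule ccontr)
  define \<beta> where "\<beta> = 1 - \<eta> * l - \<epsilon>"
  \<comment> \<open>While \<open>m k \<le> \<beta>\<close>, the coordinate along \<open>e\<close>
    grows by at least this factor per step. From \<open>\<beta> \<ge> 1\<close> follow
    \<open>r > 1\<close> and \<open>1 - \<eta> * l > 1\<close>, so the coordinate never becomes
    zero.\<close>
  define r where "r = (1 - \<eta> * l) / \<beta>"
  assume "\<not> ?thesis"
  then have le: "m k \<le> \<beta>" if "N \<le> k" for k
    using that by (force simp: \<beta>_def)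
  have \<beta>: "1 \<le> \<beta>"
    using le[of N] scale_ge_1[of N] by simp
  then have r: "1 < r"
    using \<epsilon> by (simp add: r_def \<beta>_def)
  have coord: "m k * (e \<bullet> z (Suc k)) = (1 - \<eta> * l) * (e \<bullet> z k)" for k
  proof -
    have "m k * (e \<bullet> z (Suc k)) = e \<bullet> z k - \<eta> * (e \<bullet> T (z k) + e \<bullet> b)"
      using arg_cong[OF iteration[of k], of "\<lambda>u. e \<bullet> u"]
      by (simp add: inner_diff_right inner_add_right)
    then show ?thesis
      using self_adjoint[of e "z k"] e by (simp add: algebra_simps)
  qed
  have nz: "e \<bullet> z k \<noteq> 0" for k
  proof (induction k)
    case (Suc k)
    then show ?case
      using coord[of k] \<beta> \<epsilon> by (auto simp: \<beta>_def)
  qed (use e in simp)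
  have grow: "r ^ j * \<bar>e \<bullet> z N\<bar> \<le> \<bar>e \<bullet> z (N + j)\<bar>" for j
  proof (induction j)
    case (Suc j)
    have "\<beta> * (r * \<bar>e \<bullet> z (N + j)\<bar>) = \<bar>(1 - \<eta> * l) * (e \<bullet> z (N + j))\<bar>"
      using \<beta> \<epsilon> by (simp add: r_def abs_mult \<beta>_def)
    also have "\<dots> = m (N + j) * \<bar>e \<bullet> z (Suc (N + j))\<bar>"
      using coord[of "N + j"] scale_ge_1[of "N + j"] by (simp add: abs_mult flip: coord)
    also have "\<dots> \<le> \<beta> * \<bar>e \<bullet> z (Suc (N + j))\<bar>"
      using le by (intro mult_right_mono) auto
    finally have "r * \<bar>e \<bullet> z (N + j)\<bar> \<le> \<bar>e \<bullet> z (N + Suc j)\<bar>"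
      using \<beta> by simp
    moreover have "r * (r ^ j * \<bar>e \<bullet> z N\<bar>) \<le> r * \<bar>e \<bullet> z (N + j)\<bar>"
      using Suc r by (intro mult_left_mono) auto
    ultimately show ?case
      by simp
  qed simp
  have bound: "\<bar>e \<bullet> z k\<bar> \<le> norm e" for k
    using Cauchy_Schwarz_ineq2[of e "z k"] mult_left_mono[OF norm_le_1[of k], of "norm e"] by simp
  obtain j where "norm e / \<bar>e \<bullet> z N\<bar> < r ^ j"
    using real_arch_pow[OF r] by blast
  then have "norm e < r ^ j * \<bar>e \<bullet> z N\<bar>"
    using nz[of N] by (simp add: field_simps)
  then show False
    using grow[of j] bound[of "N + j"] by linarith
qed

text \<open>A limit \<open>y\<close> along indices with large \<open>m k\<close> is a fixed point of
  the step, and the limit of these \<open>m k\<close> yields a multiplier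
  \<open>\<mu> \<ge> - l\<close>, which makes the shifted operator semidefinite. Since the objective
  values converge, their limit is the value at \<open>y\<close>.\<close>

lemma accumulates_at_kkt:
  assumes e: "T e = l *\<^sub>R e" "e \<bullet> b = 0" "e \<bullet> z 0 \<noteq> 0"
    and lower: "\<And>u. l * (u \<bullet> u) \<le> u \<bullet> T u"
  shows "\<exists>y \<mu>. kkt y \<mu> \<and> (\<lambda>k. obj (z k)) \<longlonglongrightarrow> obj y"
proof -
  have "\<forall>N. \<exists>k\<ge>N. 1 - \<eta> * l - 1 / real (Suc N) < m k"
    by (intro allI scale_frequently_large[OF e]) simp
  then obtain \<kappa> where \<kappa>: "\<And>N. N \<le> \<kappa> N" "\<And>N. 1 - \<eta> * l - 1 / real (Suc N) < m (\<kappa> N)"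
    by metis
  have "\<forall>N. z (\<kappa> N) \<in> cball 0 1"
    using norm_le_1 by simp
  then obtain y r where r: "strict_mono r" "((\<lambda>N. z (\<kappa> N)) \<circ> r) \<longlonglongrightarrow> y"
    using compact_cball[of "0::'a" 1] unfolding compact_def by meson
  \<comment> \<open>\<open>\<kappa>\<close> need not be monotone; \<open>N \<le> \<kappa> N\<close>
    still sends the selected indices to infinity.\<close>
  define \<sigma> where "\<sigma> j = \<kappa> (r j)" for j
  have \<sigma>: "filterlim \<sigma> at_top sequentially"
  proof (rule filterlim_at_top_mono)
    show "filterlim r at_top sequentially"
      using r(1) by (rule filterlim_subseq)
    show "\<forall>\<^sub>F j in sequentially. r j \<le> \<sigma> j"
      using \<kappa>(1) by (simp add: \<sigma>_def)
  qed
  have y: "(\<lambda>j. z (\<sigma> j)) \<longlonglongrightarrow> y"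
    using r(2) by (simp add: \<sigma>_def o_def)
  define g where "g = y - \<eta> *\<^sub>R (T y + b)"
  define M where "M = max 1 (norm g)"
  have "1 \<le> M"
    by (simp add: M_def)
  have lim_m: "(\<lambda>j. m (\<sigma> j)) \<longlonglongrightarrow> M"
    unfolding M_def g_def scale by (intro tendsto_intros tendsto_T y)
  \<comment> \<open>As the steps tend to 0, the successors of the selected iterates have the same
    limit, so \<open>y\<close> is a fixed point.\<close>
  have "(\<lambda>j. z (Suc (\<sigma> j)) - z (\<sigma> j) + z (\<sigma> j)) \<longlonglongrightarrow> 0 + y"
    using filterlim_compose[OF steps_tendsto_0 \<sigma>] y by (intro tendsto_intros)
  then have y': "(\<lambda>j. z (Suc (\<sigma> j))) \<longlonglongrightarrow> y"
    by simp
  have "(\<lambda>j. m (\<sigma> j) *\<^sub>R z (Suc (\<sigma> j))) \<longlonglongrightarrow> M *\<^sub>R y"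
    using lim_m y' by (intro tendsto_intros)
  moreover have "(\<lambda>j. m (\<sigma> j) *\<^sub>R z (Suc (\<sigma> j))) \<longlonglongrightarrow> g"
    unfolding iteration g_def by (intro tendsto_intros tendsto_T y)
  ultimately have fixpoint: "M *\<^sub>R y = g"
    by (rule LIMSEQ_unique)
  have "1 - \<eta> * l - 0 \<le> M"
  proof (rule LIMSEQ_le[OF _ lim_m])
    have "(\<lambda>j. 1 / real (Suc (r j))) \<longlonglongrightarrow> 0"
      using filterlim_compose[OF lim_1_over_n[THEN LIMSEQ_Suc] filterlim_subseq[OF r(1)]]
      by simp
    then show "(\<lambda>j. 1 - \<eta> * l - 1 / real (Suc (r j))) \<longlonglongrightarrow> 1 - \<eta> * l - 0"
      by (intro tendsto_intros)
    show "\<exists>N. \<forall>j\<ge>N. 1 - \<eta> * l - 1 / real (Suc (r j)) \<le> m (\<sigma> j)"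
      using \<kappa>(2) by (auto simp: \<sigma>_def intro: less_imp_le)
  qed
  \<comment> \<open>Read off from the fixed point equation
    \<open>M *\<^sub>R y = y - \<eta> *\<^sub>R (T y + b)\<close>.\<close>
  define \<mu> where "\<mu> = (M - 1) / \<eta>"
  have \<mu>: "0 \<le> \<mu>" "- l \<le> \<mu>"
    using \<open>1 - \<eta> * l - 0 \<le> M\<close> step_pos by (auto simp: \<mu>_def M_def field_simps)
  have ny: "norm y \<le> 1"
    using Lim_bounded[of "\<lambda>j. norm (z (\<sigma> j))" "norm y" 0 1] tendsto_norm[OF y] norm_le_1 by blast
  have "kkt y \<mu>"
    unfolding kkt_def
  proof (intro conjI allI)
    have "\<eta> *\<^sub>R (T y + \<mu> *\<^sub>R y + b) = \<eta> *\<^sub>R (T y + b) + (\<eta> * \<mu>) *\<^sub>R y"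
      by (simp add: scaleR_add_right)
    also have "\<dots> = M *\<^sub>R y - g"
      using step_pos by (simp add: g_def \<mu>_def scaleR_diff_left)
    finally have "\<eta> *\<^sub>R (T y + \<mu> *\<^sub>R y + b) = M *\<^sub>R y - g" .
    then show "T y + \<mu> *\<^sub>R y + b = 0"
      using fixpoint step_pos by simp
    show "\<mu> * (y \<bullet> y - 1) = 0"
    proof (cases "M = 1")
      case False
      then have "M = norm g"
        by (simp add: M_def max_def split: if_splits)
      also have "\<dots> = norm (M *\<^sub>R y)"
        by (simp only: fixpoint)
      also have "\<dots> = M * norm y"
        by (simp add: M_def)
      finally have "norm y = 1"
        using \<open>1 \<le> M\<close> by simp
      then show ?thesis
        by (simp add: norm_eq_1)
    qed (simp add: \<mu>_def)
    show "y \<bullet> y \<le> 1"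
      using ny by (simp add: norm_le_square)
    fix u :: 'a
    have "- l * (u \<bullet> u) \<le> \<mu> * (u \<bullet> u)"
      using \<mu>(2) by (intro mult_right_mono) auto
    then show "0 \<le> u \<bullet> T u + \<mu> * (u \<bullet> u)"
      using lower[of u] by simp
  qed (rule \<mu>)
  moreover have "(\<lambda>k. obj (z k)) \<longlonglongrightarrow> obj y"
  proof -
    obtain f where f: "(\<lambda>k. obj (z k)) \<longlonglongrightarrow> f"
      using convergent_obj by (auto simp: convergent_def)
    have "(\<lambda>j. obj (z (\<sigma> j))) \<longlonglongrightarrow> f"
      using filterlim_compose[OF f \<sigma>] .
    then have "f = obj y"
      using tendsto_obj[OF y] LIMSEQ_unique by blast
    then show ?thesis
      using f by simp
  qed
  ultimately show ?thesis
    by blast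
qed

text \<open>Brings the iteration into the form of \<open>residual\<close>, so that the static error
  bounds apply: \<open>g\<close> is of the order of the step length, and once \<open>l = 0\<close>
  or the iterate is on the sphere the gap is exactly
  \<open>1 / 2 * (p \<bullet> M p)\<close>.\<close>

lemma residual_bound:
  assumes kkt: "kkt y l" and lim: "(\<lambda>k. obj (z k)) \<longlonglongrightarrow> obj y"
    and a: "T a + l *\<^sub>R a + b = 0" "\<And>q. T q + l *\<^sub>R q = 0 \<Longrightarrow> a \<bullet> q = 0"
    and \<delta>: "0 < \<delta>"
  shows "\<exists>B>0. \<exists>C\<ge>0.
     \<forall>\<^sub>F k in sequentially. \<exists>p q g s. psd_operator.residual (\<lambda>u. T u + l *\<^sub>R u) a p q g s \<and>
       norm p \<le> \<delta> \<and> norm g \<le> C * norm (z (Suc k) - z k) \<and>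
       obj (z (Suc k)) - obj y \<le> B * (norm p)\<^sup>2"
proof -
  define M where "M u = T u + l *\<^sub>R u" for u
  interpret M: psd_operator M
    unfolding M_def using psd_operator_shift[OF kkt] .
  have l: "0 \<le> l"
    using kkt by (simp add: kkt_def)
  obtain B where B: "0 < B" "\<And>u. norm (M u) \<le> B * norm u" "\<And>u. (norm (M u))\<^sup>2 \<le> B * (u \<bullet> M u)"
    using M.norm_image_bound by blast
  obtain \<kappa> where \<kappa>: "0 < \<kappa>"
    "\<And>p. \<forall>q. M q = 0 \<longrightarrow> p \<bullet> q = 0 \<Longrightarrow> \<kappa> * (norm p)\<^sup>2 \<le> p \<bullet> M p"
    using M.coercive by blast
  obtain D where D: "0 < D" "\<And>u. norm (T u) \<le> D * norm u"
    using linear_bounded_pos[OF linear] by blast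
  define G where "G k = obj (z k) - obj y" for k
  have gap: "G k = 1 / 2 * ((z k - y) \<bullet> M (z k - y)) + l / 2 * (1 - z k \<bullet> z k)" for k
    unfolding G_def M_def by (rule kkt_gap[OF kkt])
  have slack: "0 \<le> l / 2 * (1 - z k \<bullet> z k)" for k
    using l inner_le_1[of k] by simp
  have G0: "G \<longlonglongrightarrow> 0"
    using tendsto_diff[OF lim tendsto_const, of "obj y"] by (simp add: G_def[abs_def])
  have Ma: "M a = - b" and My: "M y = - b"
    using a(1) kkt by (simp_all add: M_def kkt_def eq_neg_iff_add_eq_0)
  have quad: "(z k - y) \<bullet> M (z k - y) \<le> 2 * G k" for k
    using gap[of k] slack[of k] by simp
  have M_lim: "(\<lambda>k. M (z k - y)) \<longlonglongrightarrow> 0"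
  proof -
    have "(\<lambda>k. B * (2 * G k)) \<longlonglongrightarrow> B * (2 * 0)"
      by (intro tendsto_intros G0)
    then have up: "(\<lambda>k. B * (2 * G k)) \<longlonglongrightarrow> 0"
      by simp
    have "(\<lambda>k. (norm (M (z k - y)))\<^sup>2) \<longlonglongrightarrow> 0"
    proof (rule tendsto_sandwich[OF _ _ tendsto_const up])
      have "(norm (M (z k - y)))\<^sup>2 \<le> B * (2 * G k)" for k
        using B(3)[of "z k - y"] mult_left_mono[OF quad[of k] less_imp_le[OF B(1)]] by linarith
      then show "\<forall>\<^sub>F k in sequentially. (norm (M (z k - y)))\<^sup>2 \<le> B * (2 * G k)"
        by simp
    qed simp
    then have "(\<lambda>k. sqrt ((norm (M (z k - y)))\<^sup>2)) \<longlonglongrightarrow> sqrt 0"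
      by (rule tendsto_real_sqrt)
    then show ?thesis
      by (simp add: tendsto_norm_zero_iff)
  qed
  \<comment> \<open>For \<open>l > 0\<close> the vanishing gap forces \<open>norm (z k)\<close> to
    1. The unnormalised step is \<open>(1 + \<eta> * l) *\<^sub>R z k\<close> up to a vanishing
    term, so it leaves the ball and the normalisation becomes active.\<close>
  have boundary: "\<forall>\<^sub>F k in sequentially. l = 0 \<or> norm (z (Suc k)) = 1"
  proof (cases "l = 0")
    case False
    then have lpos: "0 < l"
      using l by simp
    have nz: "(\<lambda>k. norm (z k)) \<longlonglongrightarrow> 1"
    proof -
      have "(\<lambda>k. 1 - 2 * G k / l) \<longlonglongrightarrow> 1 - 2 * 0 / l"
        using lpos by (intro tendsto_intros G0) auto
      then have low: "(\<lambda>k. 1 - 2 * G k / l) \<longlonglongrightarrow> 1"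
        by simp
      show ?thesis
      proof (rule tendsto_sandwich[OF _ _ low tendsto_const])
        have "1 - 2 * G k / l \<le> norm (z k)" for k
        proof -
          have "l * (1 - z k \<bullet> z k) \<le> 2 * G k"
            using gap[of k] M.nonneg[of "z k - y"] by simp
          then have "1 - z k \<bullet> z k \<le> 2 * G k / l"
            using lpos by (simp add: field_simps)
          moreover have "z k \<bullet> z k \<le> norm (z k)"
            using mult_left_le[OF norm_le_1[of k] norm_ge_zero]
            by (simp add: power2_eq_square flip: power2_norm_eq_inner)
          ultimately show ?thesis
            by linarith
        qed
        then show "\<forall>\<^sub>F k in sequentially. 1 - 2 * G k / l \<le> norm (z k)"
          by simp
      qed (simp add: norm_le_1)
    qed
    have "(\<lambda>k. (1 + \<eta> * l) * norm (z k) - norm (\<eta> *\<^sub>R M (z k - y))) \<longlonglongrightarrow> (1 + \<eta> * l) * 1 - norm (\<eta> *\<^sub>R 0 :: 'a)"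
      by (intro tendsto_intros nz M_lim)
    then have "\<forall>\<^sub>F k in sequentially. 1 < (1 + \<eta> * l) * norm (z k) - norm (\<eta> *\<^sub>R M (z k - y))"
      by (rule order_tendstoD) (use lpos step_pos in simp)
    then show ?thesis
    proof (rule eventually_mono)
      fix k
      assume *: "1 < (1 + \<eta> * l) * norm (z k) - norm (\<eta> *\<^sub>R M (z k - y))"
      have "M (z k - y) = T (z k) + l *\<^sub>R z k + b"
        using My by (simp add: linear_diff[OF M.linear]) (simp add: M_def)
      then have "z k - \<eta> *\<^sub>R (T (z k) + b) = (1 + \<eta> * l) *\<^sub>R z k - \<eta> *\<^sub>R M (z k - y)"
        by (simp add: algebra_simps)
      then have "norm (z k - \<eta> *\<^sub>R (T (z k) + b)) \<ge> norm ((1 + \<eta> * l) *\<^sub>R z k) - norm (\<eta> *\<^sub>R M (z k - y))"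
        by (metis norm_triangle_ineq2)
      also have "norm ((1 + \<eta> * l) *\<^sub>R z k) = (1 + \<eta> * l) * norm (z k)"
        using lpos step_pos by simp
      finally have "1 < norm (z k - \<eta> *\<^sub>R (T (z k) + b))"
        using * by linarith
      then have "m k \<noteq> 1"
        using scale[of k] by simp
      then show "l = 0 \<or> norm (z (Suc k)) = 1"
        using norm_eq_1_if_scaled by blast
    qed
  qed simp
  \<comment> \<open>Coercivity bounds \<open>\<kappa> * (norm p)\<^sup>2\<close> by twice the gap,
    so this yields \<open>norm p \<le> \<delta>\<close> below.\<close>
  have small: "\<forall>\<^sub>F k in sequentially. 2 * G (Suc k) < \<kappa> * \<delta>\<^sup>2"
    using tendsto_mult_left[OF LIMSEQ_Suc[OF G0], of 2]
    by (rule order_tendstoD) (use \<kappa>(1) \<delta> in simp)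
  have "\<forall>\<^sub>F k in sequentially. \<exists>p q g s. M.residual a p q g s \<and> norm p \<le> \<delta> \<and>
      norm g \<le> ((D * \<eta> + 1) / \<eta>) * norm (z (Suc k) - z k) \<and> G (Suc k) \<le> (B / 2) * (norm p)\<^sup>2"
    using boundary small
  proof eventually_elim
    case (elim k)
    obtain p q where pq: "z (Suc k) - a = p + q" "M q = 0" "\<forall>q. M q = 0 \<longrightarrow> p \<bullet> q = 0"
      using M.kernel_decomposition by blast
    define d where "d = z (Suc k) - z k"
    \<comment> \<open>\<open>g\<close> and \<open>s\<close> arise by eliminating
      \<open>T (z k) + b\<close> from \<open>M p\<close> with the iteration rule. If
      \<open>m k = 1\<close> and \<open>l = 0\<close>, then \<open>s = 0\<close>; otherwise the new
      iterate is on the sphere, as \<open>residual\<close> demands.\<close>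
    define g where "g = (1 / \<eta>) *\<^sub>R (\<eta> *\<^sub>R T d - d)"
    define s where "s = (1 + \<eta> * l - m k) / \<eta>"
    have zS: "z (Suc k) = a + p + q"
      using pq(1) by (simp add: algebra_simps)
    have Mp: "M p = M (z (Suc k)) + b"
      using pq(2) Ma by (simp add: zS linear_add[OF M.linear])
    have "\<eta> *\<^sub>R M p = \<eta> *\<^sub>R (g + s *\<^sub>R z (Suc k))"
    proof -
      have "\<eta> *\<^sub>R M p = \<eta> *\<^sub>R (M (z (Suc k)) + b)"
        by (simp only: Mp)
      also have "\<dots> = \<eta> *\<^sub>R T d + \<eta> *\<^sub>R (T (z k) + b) + (\<eta> * l) *\<^sub>R z (Suc k)"
        by (simp add: M_def d_def linear_diff[OF linear] algebra_simps)
      also have "\<eta> *\<^sub>R (T (z k) + b) = z k - m k *\<^sub>R z (Suc k)"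
        by (simp add: iteration)
      also have "\<eta> *\<^sub>R T d + (z k - m k *\<^sub>R z (Suc k)) + (\<eta> * l) *\<^sub>R z (Suc k)
          = (\<eta> *\<^sub>R T d - d) + (1 + \<eta> * l - m k) *\<^sub>R z (Suc k)"
        by (simp add: d_def algebra_simps)
      also have "\<dots> = \<eta> *\<^sub>R (g + s *\<^sub>R z (Suc k))"
        using step_pos by (simp add: g_def s_def scaleR_add_right)
      finally show ?thesis .
    qed
    then have "M p = g + s *\<^sub>R (a + p + q)"
      using step_pos by (simp add: zS)
    moreover have sz: "s = 0 \<or> norm (z (Suc k)) = 1"
      using elim(1) norm_eq_1_if_scaled[of k] by (cases "m k = 1") (auto simp: s_def)
    moreover have "a \<bullet> q = 0"
      using a(2) pq(2) by (simp add: M_def)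
    ultimately have res: "M.residual a p q g s"
      using pq norm_le_1[of "Suc k"] zS by (simp add: M.residual_def)
    have wp: "(z (Suc k) - y) \<bullet> M (z (Suc k) - y) = p \<bullet> M p"
    proof -
      have "M (z (Suc k) - y) = M p"
        using Mp My by (simp add: linear_diff[OF M.linear])
      moreover have "(z (Suc k) - y) \<bullet> M p = M (z (Suc k) - y) \<bullet> p"
        by (rule M.self_adjoint)
      ultimately show ?thesis
        by (simp add: inner_commute)
    qed
    have "\<kappa> * (norm p)\<^sup>2 \<le> \<kappa> * \<delta>\<^sup>2"
      using \<kappa>(2)[OF pq(3)] quad[of "Suc k"] elim(2) wp by linarith
    then have "norm p \<le> \<delta>"
      using \<kappa>(1) \<delta> by (simp add: abs_le_square_iff[symmetric])
    moreover have "norm g \<le> ((D * \<eta> + 1) / \<eta>) * norm d"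
    proof -
      have "norm (\<eta> *\<^sub>R T d - d) \<le> \<eta> * norm (T d) + norm d"
        using norm_triangle_ineq4[of "\<eta> *\<^sub>R T d" d] step_pos by simp
      also have "\<dots> \<le> \<eta> * (D * norm d) + norm d"
        using D(2)[of d] step_pos by (intro add_mono mult_left_mono) auto
      finally have "(1 / \<eta>) * norm (\<eta> *\<^sub>R T d - d) \<le> (1 / \<eta>) * (\<eta> * (D * norm d) + norm d)"
        using step_pos by (intro mult_left_mono) auto
      moreover have "norm g = (1 / \<eta>) * norm (\<eta> *\<^sub>R T d - d)"
        unfolding g_def norm_scaleR using step_pos by simp
      moreover have "(1 / \<eta>) * (\<eta> * (D * norm d) + norm d) = ((D * \<eta> + 1) / \<eta>) * norm d"
        using step_pos by (simp add: field_simps)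
      ultimately show ?thesis
        by linarith
    qed
    moreover have "G (Suc k) \<le> (B / 2) * (norm p)\<^sup>2"
    proof -
      have "l * (1 - z (Suc k) \<bullet> z (Suc k)) = 0"
        using elim(1) by (auto simp: norm_eq_1)
      then have "G (Suc k) = 1 / 2 * (p \<bullet> M p)"
        using gap[of "Suc k"] wp by simp
      also have "p \<bullet> M p \<le> norm p * norm (M p)"
        by (rule norm_cauchy_schwarz)
      also have "\<dots> \<le> norm p * (B * norm p)"
        using B(2) by (intro mult_left_mono) auto
      finally show ?thesis
        by (simp add: power2_eq_square mult_ac)
    qed
    ultimately show ?case
      using res unfolding d_def by blast
  qed
  moreover have "0 < B / 2" "0 \<le> (D * \<eta> + 1) / \<eta>"
    using B(1) D(1) step_pos by auto
  ultimately show ?thesis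
    unfolding M_def[abs_def] G_def by blast
qed

text \<open>The Kurdyka--Lojasiewicz inequality along the iteration, with exponent 1/2 in the first
  lemma and exponent 3/4 in the second.\<close>

lemma linear_recurrence:
  assumes kkt: "kkt y l" and lim: "(\<lambda>k. obj (z k)) \<longlonglongrightarrow> obj y"
    and a: "T a + l *\<^sub>R a + b = 0" "\<And>q. T q + l *\<^sub>R q = 0 \<Longrightarrow> a \<bullet> q = 0"
    and regular: "norm a < 1 \<or> norm a = 1 \<and> (\<forall>q. T q + l *\<^sub>R q = 0 \<longrightarrow> q = 0)"
  shows "\<exists>C\<ge>0. \<forall>\<^sub>F k in sequentially. obj (z (Suc k)) - obj y \<le> C * (norm (z (Suc k) - z k))\<^sup>2"
proof -
  interpret M: psd_operator "\<lambda>u. T u + l *\<^sub>R u"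
    using psd_operator_shift[OF kkt] .
  have "\<exists>\<delta>>0. \<exists>C\<ge>0. \<forall>p q g s. M.residual a p q g s \<and> norm p \<le> \<delta> \<longrightarrow> norm p \<le> C * norm g"
    using regular M.linear_error_bound_interior[of a] M.linear_error_bound_injective[of a] by blast
  then obtain \<delta> E where \<delta>: "0 < \<delta>" and E: "0 \<le> E"
    "\<And>p q g s. \<lbrakk>M.residual a p q g s; norm p \<le> \<delta>\<rbrakk> \<Longrightarrow> norm p \<le> E * norm g"
    by blast
  obtain B C where B: "0 < B" and C: "0 \<le> C" and ev:
    "\<forall>\<^sub>F k in sequentially. \<exists>p q g s. M.residual a p q g s \<and>
       norm p \<le> \<delta> \<and> norm g \<le> C * norm (z (Suc k) - z k) \<and>
       obj (z (Suc k)) - obj y \<le> B * (norm p)\<^sup>2"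
    using residual_bound[OF kkt lim a \<delta>] by blast
  from ev have "\<forall>\<^sub>F k in sequentially. obj (z (Suc k)) - obj y
    \<le> (B * (E * C)\<^sup>2) * (norm (z (Suc k) - z k))\<^sup>2"
  proof (rule eventually_mono, elim exE conjE)
    fix k p q g s
    assume *: "M.residual a p q g s" "norm p \<le> \<delta>" "norm g \<le> C * norm (z (Suc k) - z k)"
      "obj (z (Suc k)) - obj y \<le> B * (norm p)\<^sup>2"
    have "norm p \<le> E * norm g"
      using E(2) * by blast
    also have "\<dots> \<le> E * (C * norm (z (Suc k) - z k))"
      using * E(1) by (intro mult_left_mono) auto
    finally have "(norm p)\<^sup>2 \<le> (E * (C * norm (z (Suc k) - z k)))\<^sup>2"
      by (intro power_mono) auto
    then have "B * (norm p)\<^sup>2 \<le> B * (E * (C * norm (z (Suc k) - z k)))\<^sup>2"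
      using B by (intro mult_left_mono) auto
    with *(4) show "obj (z (Suc k)) - obj y \<le> (B * (E * C)\<^sup>2) * (norm (z (Suc k) - z k))\<^sup>2"
      by (simp add: power_mult_distrib mult_ac)
  qed
  moreover have "0 \<le> B * (E * C)\<^sup>2"
    using B by simp
  ultimately show ?thesis
    by blast
qed

lemma cubic_recurrence:
  assumes kkt: "kkt y l" and lim: "(\<lambda>k. obj (z k)) \<longlonglongrightarrow> obj y"
  shows "\<exists>C\<ge>0. \<forall>\<^sub>F k in sequentially.
    sqrt (obj (z (Suc k)) - obj y) ^ 3 \<le> C * (norm (z (Suc k) - z k))\<^sup>2"
proof -
  interpret M: psd_operator "\<lambda>u. T u + l *\<^sub>R u"
    using psd_operator_shift[OF kkt] .
  have G: "0 \<le> obj (z k) - obj y" for k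
    using kkt_minimal[OF kkt inner_le_1] by simp
  \<comment> \<open>\<open>a\<close> is the least norm solution of the stationarity equation; by
    Pythagoras it lies in the ball because \<open>y\<close> does.\<close>
  obtain a r where ar: "y = a + r" "T r + l *\<^sub>R r = 0" "\<And>q. T q + l *\<^sub>R q = 0 \<Longrightarrow> a \<bullet> q = 0"
    using M.kernel_decomposition[of y] by blast
  have Ma: "T a + l *\<^sub>R a + b = 0"
  proof -
    have "T y + l *\<^sub>R y + b = 0"
      using kkt by (simp add: kkt_def)
    then have "(T a + l *\<^sub>R a + b) + (T r + l *\<^sub>R r) = 0"
      by (simp add: ar(1) linear_add[OF linear] algebra_simps)
    then show ?thesis
      by (simp add: ar(2))
  qed
  have "a \<bullet> a + r \<bullet> r = y \<bullet> y"
    using ar(3)[OF ar(2)] by (simp add: ar(1) inner_add_left inner_add_right inner_commute)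
  also have "y \<bullet> y \<le> 1"
    using kkt by (simp add: kkt_def)
  finally have "a \<bullet> a \<le> 1"
    using inner_ge_zero[of r] by linarith
  then have "norm a \<le> 1"
    by (simp add: norm_le_square)
  then consider "norm a < 1" | "norm a = 1"
    by linarith
  then show ?thesis
  proof cases
    case 1
    obtain C where C: "0 \<le> C" "\<forall>\<^sub>F k in sequentially. obj (z (Suc k)) - obj y
        \<le> C * (norm (z (Suc k) - z k))\<^sup>2"
      using linear_recurrence[OF kkt lim Ma ar(3)] 1 by blast
    \<comment> \<open>Here the stronger linear estimate holds; it is multiplied by the root of the
      gap, which never exceeds its initial value.\<close>
    have mono: "obj (z (Suc k)) \<le> obj (z 0)" for k
      by (induction k) (use obj_Suc_le order_trans in blast)+
    define S where "S = sqrt (obj (z 0) - obj y)"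
    have "\<forall>\<^sub>F k in sequentially. sqrt (obj (z (Suc k)) - obj y) ^ 3 \<le> (S * C) * (norm (z (Suc k) - z k))\<^sup>2"
      using C(2)
    proof (rule eventually_mono)
      fix k
      assume *: "obj (z (Suc k)) - obj y \<le> C * (norm (z (Suc k) - z k))\<^sup>2"
      have "sqrt (obj (z (Suc k)) - obj y) ^ 3 = sqrt (obj (z (Suc k)) - obj y) * (obj (z (Suc k)) - obj y)"
        using G[of "Suc k"] by (simp add: power3_eq_cube mult.assoc)
      also have "\<dots> \<le> S * (C * (norm (z (Suc k) - z k))\<^sup>2)"
        using * G mono[of k] C(1) unfolding S_def by (intro mult_mono) auto
      finally show "sqrt (obj (z (Suc k)) - obj y) ^ 3 \<le> (S * C) * (norm (z (Suc k) - z k))\<^sup>2"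
        by (simp add: mult.assoc)
    qed
    moreover have "0 \<le> S * C"
      using C(1) G by (simp add: S_def)
    ultimately show ?thesis
      by blast
  next
    case 2
    obtain \<delta> E where \<delta>: "0 < \<delta>" and E: "0 \<le> E"
      "\<And>p q g s. \<lbrakk>M.residual a p q g s; norm p \<le> \<delta>\<rbrakk> \<Longrightarrow> norm p ^ 3 \<le> E * (norm g)\<^sup>2"
      using M.cubic_error_bound[OF 2] by blast
    obtain B C where B: "0 < B" and C: "0 \<le> C" and ev:
      "\<forall>\<^sub>F k in sequentially. \<exists>p q g s. M.residual a p q g s \<and>
         norm p \<le> \<delta> \<and> norm g \<le> C * norm (z (Suc k) - z k) \<and>
         obj (z (Suc k)) - obj y \<le> B * (norm p)\<^sup>2"
      using residual_bound[OF kkt lim Ma ar(3) \<delta>] by blast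
    from ev have "\<forall>\<^sub>F k in sequentially. sqrt (obj (z (Suc k)) - obj y) ^ 3
      \<le> (sqrt B ^ 3 * (E * C\<^sup>2)) * (norm (z (Suc k) - z k))\<^sup>2"
    proof (rule eventually_mono, elim exE conjE)
      fix k p q g s
      assume *: "M.residual a p q g s" "norm p \<le> \<delta>" "norm g \<le> C * norm (z (Suc k) - z k)"
        "obj (z (Suc k)) - obj y \<le> B * (norm p)\<^sup>2"
      have "sqrt (obj (z (Suc k)) - obj y) \<le> sqrt (B * (norm p)\<^sup>2)"
        using *(4) by simp
      then have "sqrt (obj (z (Suc k)) - obj y) ^ 3 \<le> (sqrt B * norm p) ^ 3"
        using G by (intro power_mono) (auto simp: real_sqrt_mult)
      also have "\<dots> = sqrt B ^ 3 * norm p ^ 3"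
        by (rule power_mult_distrib)
      also have "\<dots> \<le> sqrt B ^ 3 * (E * (C * norm (z (Suc k) - z k))\<^sup>2)"
      proof (rule mult_left_mono)
        have "norm p ^ 3 \<le> E * (norm g)\<^sup>2"
          using E(2) * by blast
        also have "\<dots> \<le> E * (C * norm (z (Suc k) - z k))\<^sup>2"
          using *(3) E(1) by (intro mult_left_mono power_mono) auto
        finally show "norm p ^ 3 \<le> E * (C * norm (z (Suc k) - z k))\<^sup>2" .
      qed (use B in simp)
      finally show "sqrt (obj (z (Suc k)) - obj y) ^ 3
          \<le> (sqrt B ^ 3 * (E * C\<^sup>2)) * (norm (z (Suc k) - z k))\<^sup>2"
        by (simp only: power_mult_distrib mult.assoc)
    qed
    moreover have "0 \<le> sqrt B ^ 3 * (E * C\<^sup>2)"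
      using B E(1) by simp
    ultimately show ?thesis
      by blast
  qed
qed

section \<open>Convergence of the iterates and rates for the objective\<close>

lemma convergent_iterates:
  assumes kkt: "kkt y l" and lim: "(\<lambda>k. obj (z k)) \<longlonglongrightarrow> obj y"
  shows "convergent z"
proof -
  define G where "G k = obj (z k) - obj y" for k
  have G: "0 \<le> G k" for k
    using kkt_minimal[OF kkt inner_le_1] by (simp add: G_def)
  obtain C where C: "0 \<le> C"
    "\<forall>\<^sub>F k in sequentially. sqrt (G (Suc k)) ^ 3 \<le> C * (norm (z (Suc k) - z k))\<^sup>2"
    using cubic_recurrence[OF kkt lim] unfolding G_def by blast
  \<comment> \<open>The power \<open>1/4 = 1 - 3/4\<close> matches the inequality with exponent 3/4;
    with it the step lengths are summable and the path has finite length.\<close>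
  define a where "a k = sqrt (sqrt (G k))" for k
  define A where "A = a 0"
  have G_le: "G (Suc k) \<le> G k" for k
    using obj_Suc_le by (simp add: G_def)
  have "decseq G"
    using G_le by (rule decseq_SucI)
  have a2: "(a k)\<^sup>2 = sqrt (G k)" and a4: "a k ^ 4 = G k" and a0: "0 \<le> a k" for k
  proof -
    show "(a k)\<^sup>2 = sqrt (G k)"
      using G by (simp add: a_def)
    then have "((a k)\<^sup>2)\<^sup>2 = G k"
      using G by simp
    then show "a k ^ 4 = G k"
      by (simp flip: power_mult)
    show "0 \<le> a k"
      using G by (simp add: a_def)
  qed
  have aA: "a k \<le> A" for k
    using \<open>decseq G\<close> unfolding A_def a_def decseq_def by simp
  have "\<forall>\<^sub>F k in sequentially. norm (z (Suc k) - z k)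
      \<le> (15 * sqrt C / dec + 2 * A / sqrt dec) * (a k - a (Suc k))"
    using C(2)
  proof (rule eventually_mono)
    fix k
    assume *: "sqrt (G (Suc k)) ^ 3 \<le> C * (norm (z (Suc k) - z k))\<^sup>2"
    show "norm (z (Suc k) - z k) \<le> (15 * sqrt C / dec + 2 * A / sqrt dec) * (a k - a (Suc k))"
    proof (rule step_le_telescoping)
      show "dec * (norm (z (Suc k) - z k))\<^sup>2 \<le> a k ^ 4 - a (Suc k) ^ 4"
        using descent[of k] by (simp add: a4 G_def)
      have "(a (Suc k) ^ 3)\<^sup>2 = ((a (Suc k))\<^sup>2) ^ 3"
        by (simp flip: power_mult)
      also have "\<dots> \<le> (sqrt C * norm (z (Suc k) - z k))\<^sup>2"
        using * C(1) by (simp add: a2 power_mult_distrib)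
      finally show "a (Suc k) ^ 3 \<le> sqrt C * norm (z (Suc k) - z k)"
        by (rule power2_le_imp_le) (use C(1) in simp)
    qed (use a0 aA C(1) dec_pos in auto)
  qed
  moreover have "convergent a"
  proof -
    have "G \<longlonglongrightarrow> 0"
      using tendsto_diff[OF lim tendsto_const, of "obj y"] by (simp add: G_def[abs_def])
    then have "a \<longlonglongrightarrow> sqrt (sqrt 0)"
      unfolding a_def by (intro tendsto_real_sqrt)
    then show ?thesis
      by (auto simp: convergent_def)
  qed
  ultimately show ?thesis
    by (rule convergent_if_telescoping_steps)
qed

text \<open>For the root \<open>h\<close> of the gap, \<open>descent\<close> turns the cubic
  recurrence into that of \<open>inverse_linear_rate\<close>; squaring gives the rate. The start
  \<open>Suc N\<close> keeps the index positive.\<close>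

lemma sublinear_rate:
  assumes kkt: "kkt y l" and lim: "(\<lambda>k. obj (z k)) \<longlonglongrightarrow> obj y"
  shows "\<exists>K C. 1 \<le> K \<and> 0 \<le> C \<and> (\<forall>k\<ge>K. obj (z k) - obj y \<le> C / (real k)\<^sup>2)"
proof -
  define h where "h k = sqrt (obj (z k) - obj y)" for k
  have G: "0 \<le> obj (z k) - obj y" for k
    using kkt_minimal[OF kkt inner_le_1] by simp
  then have h2: "(h k)\<^sup>2 = obj (z k) - obj y" and h0: "0 \<le> h k" for k
    by (simp_all add: h_def)
  obtain C where C: "0 \<le> C"
    "\<forall>\<^sub>F k in sequentially. h (Suc k) ^ 3 \<le> C * (norm (z (Suc k) - z k))\<^sup>2"
    using cubic_recurrence[OF kkt lim] unfolding h_def by blast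
  then obtain N where N: "\<And>k. N \<le> k \<Longrightarrow> h (Suc k) ^ 3 \<le> C * (norm (z (Suc k) - z k))\<^sup>2"
    by (auto simp: eventually_sequentially)
  have "\<exists>B\<ge>0. \<forall>k\<ge>Suc N. h k \<le> B / real k"
  proof (rule inverse_linear_rate)
    fix k
    assume "Suc N \<le> k"
    then have "h (Suc k) ^ 3 \<le> C * (norm (z (Suc k) - z k))\<^sup>2"
      by (intro N) simp
    also have "\<dots> \<le> C * ((obj (z k) - obj (z (Suc k))) / dec)"
      using descent[of k] dec_pos C(1) by (intro mult_left_mono) (auto simp: field_simps)
    finally show "h (Suc k) ^ 3 \<le> (C / dec) * ((h k)\<^sup>2 - (h (Suc k))\<^sup>2)"
      by (simp add: h2)
  qed (use C(1) dec_pos h0 in auto)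
  then obtain B where B: "0 \<le> B" "\<And>k. Suc N \<le> k \<Longrightarrow> h k \<le> B / real k"
    by blast
  have "obj (z k) - obj y \<le> B\<^sup>2 / (real k)\<^sup>2" if "Suc N \<le> k" for k
    using power_mono[OF B(2)[OF that] h0, of 2] by (simp add: h2 power_divide)
  then show ?thesis
    by (intro exI[of _ "Suc N"] exI[of _ "B\<^sup>2"]) auto
qed

lemma linear_rate:
  assumes kkt: "kkt y l" and lim: "(\<lambda>k. obj (z k)) \<longlonglongrightarrow> obj y"
    and regular: "(\<exists>a. T a + l *\<^sub>R a + b = 0 \<and> norm a < 1) \<or> (\<forall>q. T q + l *\<^sub>R q = 0 \<longrightarrow> q = 0)"
  shows "\<exists>K C \<rho>. 0 \<le> C \<and> 0 < \<rho> \<and> \<rho> < 1 \<and> (\<forall>k\<ge>K. obj (z k) - obj y \<le> C * \<rho> ^ k)"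
proof -
  interpret M: psd_operator "\<lambda>u. T u + l *\<^sub>R u"
    using psd_operator_shift[OF kkt] .
  have y: "T y + l *\<^sub>R y + b = 0" "y \<bullet> y \<le> 1"
    using kkt by (simp_all add: kkt_def)
  obtain a where a: "T a + l *\<^sub>R a + b = 0" "\<And>q. T q + l *\<^sub>R q = 0 \<Longrightarrow> a \<bullet> q = 0"
    "norm a < 1 \<or> norm a = 1 \<and> (\<forall>q. T q + l *\<^sub>R q = 0 \<longrightarrow> q = 0)"
  proof -
    \<comment> \<open>Removing the kernel component of a solution \<open>w\<close> gives the least
      norm solution. With a trivial kernel \<open>w\<close> is taken to be \<open>y\<close>, known
      only to have norm at most 1, hence the two alternatives.\<close>
    from regular obtain w where w: "T w + l *\<^sub>R w + b = 0"
      "norm w < 1 \<or> norm w \<le> 1 \<and> (\<forall>q. T q + l *\<^sub>R q = 0 \<longrightarrow> q = 0)"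
      using y by (auto simp: norm_le_square)
    obtain a r where ar: "w = a + r" "T r + l *\<^sub>R r = 0" "\<And>q. T q + l *\<^sub>R q = 0 \<Longrightarrow> a \<bullet> q = 0"
      using M.kernel_decomposition[of w] by blast
    have "(T a + l *\<^sub>R a + b) + (T r + l *\<^sub>R r) = 0"
      using w(1) by (simp add: ar(1) linear_add[OF linear] algebra_simps)
    then have "T a + l *\<^sub>R a + b = 0"
      by (simp add: ar(2))
    have "norm a \<le> norm w"
      using ar(3)[OF ar(2)] unfolding norm_le
      by (simp add: ar(1) inner_add_left inner_add_right inner_commute)
    have "norm a < 1 \<or> norm a = 1 \<and> (\<forall>q. T q + l *\<^sub>R q = 0 \<longrightarrow> q = 0)"
    proof (cases "norm a < 1")
      case False
      then have "\<not> norm w < 1"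
        using \<open>norm a \<le> norm w\<close> by linarith
      with w(2) have w': "norm w \<le> 1" "\<forall>q. T q + l *\<^sub>R q = 0 \<longrightarrow> q = 0"
        by blast+
      then have "norm a = 1"
        using False \<open>norm a \<le> norm w\<close> by linarith
      with w'(2) show ?thesis
        by blast
    qed blast
    then show ?thesis
      by - (rule that[OF \<open>T a + l *\<^sub>R a + b = 0\<close> ar(3)])
  qed
  obtain C where C: "0 \<le> C" "\<forall>\<^sub>F k in sequentially. obj (z (Suc k)) - obj y
      \<le> C * (norm (z (Suc k) - z k))\<^sup>2"
    using linear_recurrence[OF kkt lim a] by blast
  then obtain K where K: "\<And>k. K \<le> k \<Longrightarrow> obj (z (Suc k)) - obj y \<le> C * (norm (z (Suc k) - z k))\<^sup>2"
    by (auto simp: eventually_sequentially)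
  have "\<exists>C \<rho>. 0 \<le> C \<and> 0 < \<rho> \<and> \<rho> < 1 \<and> (\<forall>k\<ge>K. obj (z k) - obj y \<le> C * \<rho> ^ k)"
  proof (rule geometric_rate)
    \<comment> \<open>\<open>C\<close> may be 0, while \<open>geometric_rate\<close> asks for a
      strictly positive constant.\<close>
    show "0 < (C + 1) / dec"
      using C(1) dec_pos by simp
    show "0 \<le> obj (z k) - obj y" for k
      using kkt_minimal[OF kkt inner_le_1] by simp
    fix k
    assume "K \<le> k"
    then have "obj (z (Suc k)) - obj y \<le> C * (norm (z (Suc k) - z k))\<^sup>2"
      by (rule K)
    also have "\<dots> \<le> (C + 1) * (norm (z (Suc k) - z k))\<^sup>2"
      by (intro mult_right_mono) auto
    also have "\<dots> \<le> (C + 1) * ((obj (z k) - obj (z (Suc k))) / dec)"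
      using descent[of k] dec_pos C(1) by (intro mult_left_mono) (auto simp: field_simps)
    finally show "obj (z (Suc k)) - obj y
        \<le> (C + 1) / dec * ((obj (z k) - obj y) - (obj (z (Suc k)) - obj y))"
      by simp
  qed
  then show ?thesis
    by blast
qed

text \<open>By continuity the limit has the optimal value, so \<open>kkt_of_obj_eq\<close> gives it
  the multiplier of \<open>y\<close>.\<close>

lemma limit_kkt:
  assumes kkt: "kkt y l" and lim: "(\<lambda>k. obj (z k)) \<longlonglongrightarrow> obj y"
  shows "\<exists>u. z \<longlonglongrightarrow> u \<and> kkt u l"
proof -
  obtain u where u: "z \<longlonglongrightarrow> u"
    using convergent_iterates[OF assms] by (auto simp: convergent_def)
  have "obj u = obj y"
    using tendsto_obj[OF u] lim LIMSEQ_unique by blast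
  moreover have "norm u \<le> 1"
    using Lim_bounded[OF tendsto_norm[OF u], of 0 1] norm_le_1 by blast
  ultimately have "kkt u l"
    by (intro kkt_of_obj_eq[OF kkt]) (simp_all add: norm_le_square)
  with u show ?thesis
    by blast
qed

end

text \<open>\<open>v\<close> minimises the Rayleigh quotient. The form of \<open>T - l\<close> is
  then nonnegative and vanishes at \<open>v\<close>, which by \<open>kernel_iff\<close> is the
  eigenvector equation.\<close>

lemma (in quadratic) min_eigenvector:
  "\<exists>l v. v \<noteq> 0 \<and> T v = l *\<^sub>R v \<and> (\<forall>u. l * (u \<bullet> u) \<le> u \<bullet> T u)"
proof -
  have "sphere (0::'a) 1 \<noteq> {}"
    using norm_Basis[OF SOME_Basis[where 'a = 'a]] by (metis dist_0_norm empty_iff mem_sphere)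
  moreover have "continuous_on (sphere 0 1) (\<lambda>u. u \<bullet> T u)"
    by (intro continuous_intros continuous_on_subset[OF continuous_T]) auto
  ultimately obtain v where v: "v \<in> sphere 0 1" "\<And>u. u \<in> sphere 0 1 \<Longrightarrow> v \<bullet> T v \<le> u \<bullet> T u"
    using continuous_attains_inf[of "sphere 0 1" "\<lambda>u. u \<bullet> T u"] compact_sphere by blast
  have vv: "v \<bullet> v = 1"
    using v(1) by (simp add: norm_eq_1)
  define l where "l = v \<bullet> T v"
  have lower: "l * (u \<bullet> u) \<le> u \<bullet> T u" for u
  proof (cases "u = 0")
    case False
    have "(1 / norm u) *\<^sub>R u \<in> sphere 0 1"
      using False by simp
    then have "l \<le> ((1 / norm u) *\<^sub>R u) \<bullet> T ((1 / norm u) *\<^sub>R u)"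
      unfolding l_def by (rule v(2))
    also have "\<dots> = (u \<bullet> T u) / (u \<bullet> u)"
      by (simp add: linear_scale[OF linear] power2_norm_eq_inner[symmetric] power2_eq_square)
    finally show ?thesis
      using False by (simp add: field_simps)
  qed simp
  have "psd_operator (\<lambda>u. T u - l *\<^sub>R u)"
  proof (rule psd_operator.intro)
    show "linear (\<lambda>u. T u - l *\<^sub>R u)"
      by (intro linear_compose_sub linear linear_scaleR)
  qed (use lower self_adjoint in \<open>auto simp: inner_diff_left inner_diff_right\<close>)
  then interpret psd_operator "\<lambda>u. T u - l *\<^sub>R u" .
  have "v \<bullet> (T v - l *\<^sub>R v) = 0"
    by (simp add: inner_diff_right vv l_def)
  then have "T v = l *\<^sub>R v"
    by (simp add: kernel_iff)
  moreover have "v \<noteq> 0"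
    using vv by auto
  ultimately show ?thesis
    using lower by blast
qed

section \<open>Matrices\<close>

lemma mat_vector_mult: "mat l *v x = l *\<^sub>R (x :: real ^ 'n)"
  by (simp add: vec_eq_iff matrix_vector_mult_def mat_def if_distrib[of "\<lambda>a. a * _"] cong: if_cong)

lemma symmetric_matrix_inner:
  fixes H :: "real ^ 'n ^ 'n"
  shows "transpose H = H \<longleftrightarrow> (\<forall>u v. u \<bullet> (H *v v) = (H *v u) \<bullet> v)"
proof
  assume "transpose H = H"
  then show "\<forall>u v. u \<bullet> (H *v v) = (H *v u) \<bullet> v"
    by (metis dot_lmul_matrix transpose_matrix_vector)
next
  assume *: "\<forall>u v. u \<bullet> (H *v v) = (H *v u) \<bullet> v"
  have "(transpose H *v u) \<bullet> v = (H *v u) \<bullet> v" for u v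
    using * by (metis dot_lmul_matrix transpose_matrix_vector)
  then show "transpose H = H"
    by (metis matrix_eq vector_eq_rdot)
qed

lemma min_eigenvalue:
  fixes H :: "real ^ 'n ^ 'n"
  assumes "transpose H = H"
  shows "is_eigenvalue H (min_eigenvalue H)"
    and "min_eigenvalue H * (u \<bullet> u) \<le> u \<bullet> (H *v u)"
proof -
  interpret quadratic "\<lambda>v. H *v v" 0
    using assms by (intro quadratic.intro) (auto simp: symmetric_matrix_inner)
  obtain l v where l: "v \<noteq> 0" "H *v v = l *\<^sub>R v" "\<And>u. l * (u \<bullet> u) \<le> u \<bullet> (H *v u)"
    using min_eigenvector by blast
  have "min_eigenvalue H = l"
    unfolding min_eigenvalue_def
  proof (rule Least_equality)
    show "is_eigenvalue H l"
      using l by (auto simp: is_eigenvalue_def)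
    fix l'
    assume "is_eigenvalue H l'"
    then obtain w where "w \<noteq> 0" "H *v w = l' *\<^sub>R w"
      by (auto simp: is_eigenvalue_def)
    then have "l * (w \<bullet> w) \<le> l' * (w \<bullet> w)" "0 < w \<bullet> w"
      using l(3)[of w] by simp_all
    then show "l \<le> l'"
      by (rule mult_right_le_imp_le)
  qed
  then show "is_eigenvalue H (min_eigenvalue H)"
    and "min_eigenvalue H * (u \<bullet> u) \<le> u \<bullet> (H *v u)"
    using l by (auto simp: is_eigenvalue_def)
qed

section \<open>The Moore-Penrose pseudoinverse\<close>

lemma is_pseudoinverse_unique:
  assumes P: "is_pseudoinverse A P" and Q: "is_pseudoinverse A Q"
  shows "P = Q"
proof -
  have P': "A ** P ** A = A" "P ** A ** P = P" "transpose (A ** P) = A ** P" "transpose (P ** A) = P ** A"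
    and Q': "A ** Q ** A = A" "Q ** A ** Q = Q" "transpose (A ** Q) = A ** Q" "transpose (Q ** A) = Q ** A"
    using P Q by (auto simp: is_pseudoinverse_def)
  \<comment> \<open>\<open>A ** P\<close> and \<open>A ** Q\<close> are both the orthogonal
    projection onto the range of \<open>A\<close>; \<open>P ** A\<close> and \<open>Q ** A\<close>
    both project onto the complement of its kernel.\<close>
  have "A ** P = (A ** Q) ** (A ** P)"
    by (simp add: matrix_mul_assoc Q')
  also have "\<dots> = transpose ((A ** P) ** (A ** Q))"
    by (simp only: matrix_transpose_mul[of "A ** P" "A ** Q"] P' Q')
  also have "\<dots> = A ** Q"
    by (simp add: matrix_mul_assoc P' Q')
  finally have AP: "A ** P = A ** Q" .
  have "P ** A = (P ** A) ** (Q ** A)"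
    by (metis matrix_mul_assoc Q'(1))
  also have "\<dots> = transpose ((Q ** A) ** (P ** A))"
    by (simp only: matrix_transpose_mul[of "Q ** A" "P ** A"] P' Q')
  also have "(Q ** A) ** (P ** A) = Q ** A"
    by (metis matrix_mul_assoc P'(1))
  also have "transpose (Q ** A) = Q ** A"
    by (rule Q')
  finally have PA: "P ** A = Q ** A" .
  have "P = Q ** A ** P"
    by (simp only: P'(2) flip: PA)
  also have "\<dots> = Q ** A ** Q"
    by (simp only: AP flip: matrix_mul_assoc)
  finally show ?thesis
    by (simp only: Q')
qed

text \<open>With \<open>K\<close> the orthogonal projection onto the kernel, \<open>A + K\<close> is
  invertible, and \<open>P\<close> applies its inverse to \<open>u - K u\<close>. Both products of
  \<open>A\<close> and \<open>P\<close> are then the symmetric map \<open>u - K u\<close>.\<close>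

lemma is_pseudoinverse_exists:
  fixes A :: "real ^ 'n ^ 'n"
  assumes "psd_operator (\<lambda>v. A *v v)"
  shows "\<exists>P. is_pseudoinverse A P"
proof -
  interpret psd_operator "\<lambda>v. A *v v"
    by (rule assms)
  have "\<forall>u. \<exists>q. A *v q = 0 \<and> (\<forall>q'. A *v q' = 0 \<longrightarrow> (u - q) \<bullet> q' = 0)"
    using kernel_decomposition by (metis add_diff_cancel_right')
  then obtain K where K: "\<And>u. A *v K u = 0" "\<And>u q. A *v q = 0 \<Longrightarrow> (u - K u) \<bullet> q = 0"
    by metis
  have K_unique: "K u = q" if "A *v q = 0" "\<And>q'. A *v q' = 0 \<Longrightarrow> (u - q) \<bullet> q' = 0" for u q
  proof -
    have *: "A *v (q - K u) = 0"
      using K(1)[of u] that(1) by (simp add: matrix_vector_mult_diff_distrib)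
    have "(q - K u) \<bullet> (q - K u) = (u - K u) \<bullet> (q - K u) - (u - q) \<bullet> (q - K u)"
      by (simp add: inner_diff_left)
    also have "\<dots> = 0"
      using K(2)[OF *, of u] that(2)[OF *] by simp
    finally show ?thesis
      by simp
  qed
  have K_linear: "linear K"
  proof (rule linearI)
    fix u v :: "real ^ 'n" and r :: real
    show "K (u + v) = K u + K v"
    proof (rule K_unique)
      show "A *v (K u + K v) = 0"
        by (simp add: matrix_vector_right_distrib K)
      fix q
      assume "A *v q = 0"
      then show "(u + v - (K u + K v)) \<bullet> q = 0"
        using K(2)[of q u] K(2)[of q v] by (simp add: inner_diff_left inner_add_left)
    qed
    show "K (r *\<^sub>R u) = r *\<^sub>R K u"
    proof (rule K_unique)
      show "A *v (r *\<^sub>R K u) = 0"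
        by (simp add: matrix_vector_mult_scaleR K)
      fix q
      assume "A *v q = 0"
      then show "(r *\<^sub>R u - r *\<^sub>R K u) \<bullet> q = 0"
        using K(2)[of q u] by (simp flip: scaleR_diff_right)
    qed
  qed
  have K_ker: "K q = q" if "A *v q = 0" for q
    using that by (intro K_unique) auto
  have K_range: "K (A *v x) = 0" for x
    by (rule K_unique) (auto simp: self_adjoint[symmetric])
  have K_sym: "u \<bullet> K v = K u \<bullet> v" for u v
    using K(2)[OF K(1)[of v], of u] K(2)[OF K(1)[of u], of v]
    by (simp add: inner_diff_left inner_commute[of v "K u"] inner_commute[of "K v" "K u"])
  define N where "N u = A *v u + K u" for u
  have N_linear: "linear N"
    unfolding N_def by (intro linear_compose_add linear K_linear)
  have KN: "K (N u) = K u" for u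
    by (simp add: N_def linear_add[OF K_linear] K_range K_ker K)
  have "inj N"
    unfolding linear_injective_0[OF N_linear]
  proof (intro allI impI)
    fix u
    assume "N u = 0"
    then have "K u = 0"
      using KN[of u] by (simp add: linear_0[OF K_linear])
    with \<open>N u = 0\<close> have "A *v u = 0"
      by (simp add: N_def)
    then show "u = 0"
      using K_ker \<open>K u = 0\<close> by simp
  qed
  then obtain N' where N': "linear N'" "\<And>u. N' (N u) = u" "\<And>u. N (N' u) = u"
    using linear_injective_isomorphism[OF N_linear] by blast
  define P where "P = matrix (\<lambda>u. N' (u - K u))"
  have "linear (\<lambda>u. N' (u - K u))"
    using linear_compose[OF linear_compose_sub[OF linear_id K_linear] N'(1)] by (simp add: o_def)
  then have P: "P *v u = N' (u - K u)" for u
    unfolding P_def by (simp add: matrix_works)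
  have AP: "A *v (P *v u) = u - K u" and KP: "K (P *v u) = 0" for u
  proof -
    define w where "w = N' (u - K u)"
    have Nw: "N w = u - K u"
      by (simp add: w_def N')
    then have "K w = K (u - K u)"
      using KN[of w] by simp
    also have "\<dots> = 0"
      by (simp add: linear_diff[OF K_linear] K_ker K)
    finally show "K (P *v u) = 0"
      by (simp add: P w_def)
    with Nw show "A *v (P *v u) = u - K u"
      by (simp add: P w_def[symmetric] N_def)
  qed
  have PA: "P *v (A *v u) = u - K u" for u
  proof -
    have "N (u - K u) = A *v u"
      by (simp add: N_def matrix_vector_mult_diff_distrib linear_diff[OF K_linear] K_ker K)
    then show ?thesis
      using N'(2)[of "u - K u"] by (simp add: P K_range)
  qed
  have "is_pseudoinverse A P"
    unfolding is_pseudoinverse_def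
  proof (intro conjI)
    show "A ** P ** A = A"
      by (simp add: matrix_eq PA matrix_vector_mult_diff_distrib K flip: matrix_vector_mul_assoc)
    show "P ** A ** P = P"
      by (simp add: matrix_eq PA KP flip: matrix_vector_mul_assoc)
    show "transpose (A ** P) = A ** P" "transpose (P ** A) = P ** A"
      unfolding symmetric_matrix_inner
      by (simp_all add: AP PA inner_diff_left inner_diff_right K_sym flip: matrix_vector_mul_assoc)
  qed
  then show ?thesis
    by blast
qed

lemma is_pseudoinverse_pseudoinverse:
  assumes "psd_operator (\<lambda>v. A *v v)"
  shows "is_pseudoinverse A (pseudoinverse A)"
  unfolding pseudoinverse_def
  using is_pseudoinverse_exists[OF assms] is_pseudoinverse_unique by (metis theI)

text \<open>\<open>P ** A\<close> is a symmetric projection that fixes \<open>p = P *v c\<close> and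
  annihilates \<open>x - p\<close>, so these two are orthogonal and Pythagoras applies.\<close>

lemma pseudoinverse_least_norm:
  assumes A: "psd_operator (\<lambda>v. A *v v)" and x: "A *v x = c"
  shows "A *v (pseudoinverse A *v c) = c" and "norm (pseudoinverse A *v c) \<le> norm x"
proof -
  define P where "P = pseudoinverse A"
  define p where "p = P *v c"
  have P: "A ** P ** A = A" "P ** A ** P = P" "transpose (P ** A) = P ** A"
    using is_pseudoinverse_pseudoinverse[OF A] by (simp_all add: is_pseudoinverse_def P_def)
  have "A *v p = (A ** P ** A) *v x"
    by (simp only: p_def x flip: matrix_vector_mul_assoc)
  then show Ap: "A *v (pseudoinverse A *v c) = c"
    by (simp only: P x p_def P_def[symmetric])
  have "p \<bullet> (x - p) = ((P ** A ** P) *v c) \<bullet> (x - p)"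
    by (simp only: P p_def)
  also have "\<dots> = ((P ** A) *v p) \<bullet> (x - p)"
    by (simp only: p_def matrix_vector_mul_assoc)
  also have "\<dots> = p \<bullet> ((P ** A) *v (x - p))"
    using P(3) by (simp only: symmetric_matrix_inner)
  also have "\<dots> = 0"
    using Ap x by (simp add: matrix_vector_mult_diff_distrib p_def P_def flip: matrix_vector_mul_assoc)
  finally have "(norm x)\<^sup>2 = (norm p)\<^sup>2 + (norm (x - p))\<^sup>2"
    by (simp add: power2_norm_eq_inner inner_diff_left inner_diff_right inner_commute)
  then have "(norm p)\<^sup>2 \<le> (norm x)\<^sup>2"
    by simp
  then show "norm (pseudoinverse A *v c) \<le> norm x"
    unfolding p_def P_def by (rule power2_le_imp_le) simp
qed

section \<open>The trust region subproblem and its doubling\<close>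

abbreviation double_map :: "real ^ 'n ^ 'n \<Rightarrow> (real ^ 'n) \<times> (real ^ 'n) \<Rightarrow> (real ^ 'n) \<times> (real ^ 'n)" where
  "double_map H z \<equiv> (H *v fst z, H *v snd z)"

abbreviation trs_kkt :: "real ^ 'n ^ 'n \<Rightarrow> real ^ 'n \<Rightarrow> real ^ 'n \<Rightarrow> real \<Rightarrow> bool" where
  "trs_kkt H c \<equiv> quadratic.kkt (\<lambda>v. H *v v) c"

abbreviation dbl_kkt :: "real ^ 'n ^ 'n \<Rightarrow> real ^ 'n \<Rightarrow> (real ^ 'n) \<times> (real ^ 'n) \<Rightarrow> real \<Rightarrow> bool" where
  "dbl_kkt H c \<equiv> quadratic.kkt (double_map H) (c, 0)"

lemma quadratic_matrix:
  fixes H :: "real ^ 'n ^ 'n"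
  assumes "transpose H = H"
  shows "quadratic (\<lambda>v. H *v v)"
  using assms by (intro quadratic.intro) (auto simp: symmetric_matrix_inner)

lemma linear_double_map: "linear (double_map H)"
  by (rule linearI) (simp_all add: matrix_vector_right_distrib matrix_vector_mult_scaleR)

lemma quadratic_double:
  assumes "transpose H = H"
  shows "quadratic (double_map H)"
  using assms by (intro quadratic.intro linear_double_map) (simp add: symmetric_matrix_inner inner_prod_def)

lemma trs_objective_eq: "transpose H = H \<Longrightarrow> trs_objective H c = quadratic.obj (\<lambda>v. H *v v) c"
  by (simp add: fun_eq_iff trs_objective_def quadratic.obj_def[OF quadratic_matrix])

lemma dbl_objective_eq: "transpose H = H \<Longrightarrow> dbl_objective H c = quadratic.obj (double_map H) (c, 0)"
  by (simp add: fun_eq_iff dbl_objective_def quadratic.obj_def[OF quadratic_double] inner_prod_def algebra_simps)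

lemma mem_ball2n: "z \<in> ball2n \<longleftrightarrow> z \<bullet> z \<le> 1"
  by (cases z) (simp add: ball2n_def)

lemma trs_minimizer_if_kkt:
  assumes "transpose H = H" "trs_kkt H c x l"
  shows "trs_minimizer H c x"
  using assms quadratic.kkt_minimal[OF quadratic_matrix[OF assms(1)] assms(2)]
  by (auto simp: trs_minimizer_def is_arg_min_linorder trs_objective_eq quadratic.kkt_def[OF quadratic_matrix])

lemma dbl_minimizer_if_kkt:
  assumes "transpose H = H" "dbl_kkt H c z l"
  shows "dbl_minimizer H c z" and "dbl_optimal_value H c = dbl_objective H c z"
proof -
  have z: "z \<in> ball2n" "\<And>w. w \<in> ball2n \<Longrightarrow> dbl_objective H c z \<le> dbl_objective H c w"
    using assms quadratic.kkt_minimal[OF quadratic_double[OF assms(1)] assms(2)]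
    by (simp_all add: mem_ball2n dbl_objective_eq quadratic.kkt_def[OF quadratic_double])
  then show "dbl_minimizer H c z"
    by (auto simp: dbl_minimizer_def is_arg_min_linorder)
  show "dbl_optimal_value H c = dbl_objective H c z"
    unfolding dbl_optimal_value_def by (rule cInf_eq_minimum) (use z in auto)
qed

lemma trs_multiplier_eq:
  assumes H: "transpose H = H" and kkt: "trs_kkt H c x l"
  shows "trs_multiplier H c = l"
  unfolding trs_multiplier_def
proof (rule the_equality)
  interpret quadratic "\<lambda>v. H *v v" c
    using H by (rule quadratic_matrix)
  have min: "trs_minimizer H c x"
    using assms by (rule trs_minimizer_if_kkt)
  have "trs_kkt H c w l" if "trs_minimizer H c w" for w
    using that min kkt
    by (intro kkt_of_obj_eq[OF kkt])
      (auto simp: trs_minimizer_def is_arg_min_linorder trs_objective_eq[OF H] intro: antisym)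
  then show "0 \<le> l \<and> (\<forall>w. trs_minimizer H c w \<longrightarrow> (H + mat l) *v w + c = 0 \<and> l * (w \<bullet> w - 1) = 0)"
    using kkt by (auto simp: kkt_def matrix_vector_mult_add_rdistrib mat_vector_mult)
  fix l'
  assume "0 \<le> l' \<and> (\<forall>w. trs_minimizer H c w \<longrightarrow> (H + mat l') *v w + c = 0 \<and> l' * (w \<bullet> w - 1) = 0)"
  then have l': "(H *v x + l' *\<^sub>R x) + c = 0" "l' * (x \<bullet> x - 1) = 0"
    using min by (auto simp: matrix_vector_mult_add_rdistrib mat_vector_mult)
  have l: "(H *v x + l *\<^sub>R x) + c = 0" "l * (x \<bullet> x - 1) = 0"
    using kkt by (simp_all add: kkt_def)
  have "(l' - l) *\<^sub>R x = ((H *v x + l' *\<^sub>R x) + c) - ((H *v x + l *\<^sub>R x) + c)"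
    by (simp add: algebra_simps)
  also have "\<dots> = 0"
    by (simp only: l l' diff_self)
  finally have "l' = l \<or> x = 0"
    by simp
  \<comment> \<open>At \<open>x = 0\<close> stationarity does not see the multiplier, but
    complementarity then forces both to be 0.\<close>
  then show "l' = l"
    using l(2) l'(2) by auto
qed

text \<open>\<open>y\<close> lies in the kernel of \<open>H + l\<close>, so moving from
  \<open>x\<close> along \<open>y\<close> keeps stationarity. The step \<open>t\<close> is the
  larger root of \<open>norm (x + t *\<^sub>R y) = 1\<close>, real because \<open>x\<close> is in
  the ball; on the sphere complementarity is automatic.\<close>

lemma recovered_point_kkt:
  assumes H: "transpose H = H" and kkt: "dbl_kkt H c (x, y) l"
  shows "trs_kkt H c (recovered_point x y) l"
proof -
  note kkt_def = quadratic.kkt_def[OF quadratic_matrix[OF H]] quadratic.kkt_def[OF quadratic_double[OF H]]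
  have x: "H *v x + l *\<^sub>R x + c = 0" and y: "H *v y + l *\<^sub>R y = 0" and l: "0 \<le> l"
    and slack: "l * (x \<bullet> x + y \<bullet> y - 1) = 0" "x \<bullet> x + y \<bullet> y \<le> 1"
    using kkt by (simp_all add: kkt_def zero_prod_def)
  have psd: "0 \<le> u \<bullet> (H *v u) + l * (u \<bullet> u)" for u
  proof -
    have "\<forall>z. 0 \<le> z \<bullet> double_map H z + l * (z \<bullet> z)"
      using kkt unfolding kkt_def by blast
    from spec[OF this, of "(u, 0)"] show ?thesis
      by simp
  qed
  show ?thesis
  proof (cases "y = 0")
    case True
    then show ?thesis
      using x l slack psd by (simp add: recovered_point_def kkt_def)
  next
    case False
    define n where "n = y \<bullet> y"
    define s where "s = x \<bullet> y"
    define D where "D = s\<^sup>2 - n * (x \<bullet> x - 1)"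
    define t where "t = (sqrt D - s) / n"
    define w where "w = x + t *\<^sub>R y"
    have n: "0 < n"
      using False by (simp add: n_def)
    have w: "recovered_point x y = w"
      using False by (simp add: recovered_point_def w_def t_def D_def n_def s_def)
    have "x \<bullet> x \<le> 1"
      using slack(2) inner_ge_zero[of y] by linarith
    then have "n * (x \<bullet> x - 1) \<le> 0"
      using n by (simp add: mult_le_0_iff)
    then have "0 \<le> D"
      unfolding D_def using zero_le_power2[of s] by linarith
    have "n * t + s = sqrt D"
      using n by (simp add: t_def)
    then have "(n * t + s)\<^sup>2 = D"
      using \<open>0 \<le> D\<close> by simp
    then have "n * (n * t\<^sup>2 + 2 * t * s + x \<bullet> x) = n * 1"
      by (simp add: D_def power2_eq_square algebra_simps)
    then have "n * t\<^sup>2 + 2 * t * s + x \<bullet> x = 1"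
      using n by simp
    moreover have "w \<bullet> w = n * t\<^sup>2 + 2 * t * s + x \<bullet> x"
      by (simp add: w_def n_def s_def inner_add_left inner_add_right inner_commute power2_eq_square)
    ultimately have ww: "w \<bullet> w = 1"
      by simp
    have "H *v w + l *\<^sub>R w + c = (H *v x + l *\<^sub>R x + c) + t *\<^sub>R (H *v y + l *\<^sub>R y)"
      by (simp add: w_def matrix_vector_right_distrib matrix_vector_mult_scaleR algebra_simps)
    then have "H *v w + l *\<^sub>R w + c = 0"
      by (simp add: x y)
    then show ?thesis
      using l psd ww by (simp add: w kkt_def)
  qed
qed

text \<open>Semidefiniteness gives \<open>l \<ge> - \<mu>\<close>. If this is strict,
  \<open>H + l\<close> is positive definite. If \<open>l = - \<mu>\<close>, the first two conditions
  of \<open>ill_case\<close> hold, so the least norm solution cannot have norm 1; nor can it exceed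
  1, since \<open>- w\<close> is a solution in the ball.\<close>

lemma well_case_regular:
  assumes H: "transpose H = H" and kkt: "dbl_kkt H c z l" and well: "well_case H c"
  shows "(\<exists>a. double_map H a + l *\<^sub>R a + (c, 0) = 0 \<and> norm a < 1) \<or>
    (\<forall>q. double_map H q + l *\<^sub>R q = 0 \<longrightarrow> q = 0)"
proof -
  obtain x y where z: "z = (x, y)"
    by fastforce
  define w where "w = recovered_point x y"
  define \<mu> where "\<mu> = min_eigenvalue H"
  note kkt_def = quadratic.kkt_def[OF quadratic_matrix[OF H]]
  have w: "trs_kkt H c w l"
    using recovered_point_kkt[OF H] kkt by (simp add: w_def z)
  have \<mu>: "\<mu> * (u \<bullet> u) \<le> u \<bullet> (H *v u)" for u
    unfolding \<mu>_def by (rule min_eigenvalue(2)[OF H])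
  obtain v where v: "v \<noteq> 0" "H *v v = \<mu> *\<^sub>R v"
    using min_eigenvalue(1)[OF H] by (auto simp: is_eigenvalue_def \<mu>_def)
  have "0 \<le> v \<bullet> (H *v v) + l * (v \<bullet> v)"
    using w by (simp add: kkt_def)
  then have "0 \<le> (\<mu> + l) * (v \<bullet> v)"
    by (simp add: v distrib_right)
  then have "0 \<le> \<mu> + l"
    using v(1) by (metis inner_gt_zero_iff mult_neg_pos not_le)
  show ?thesis
  proof (cases "l = - \<mu>")
    case False
    have ker: "u = 0" if "H *v u + l *\<^sub>R u = 0" for u
    proof (rule ccontr)
      assume "u \<noteq> 0"
      have "u \<bullet> (H *v u) + l * (u \<bullet> u) = u \<bullet> (H *v u + l *\<^sub>R u)"
        by (simp add: inner_add_right)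
      also have "\<dots> = 0"
        by (simp add: that)
      finally have "(\<mu> + l) * (u \<bullet> u) \<le> 0"
        using \<mu>[of u] by (simp add: distrib_right)
      moreover have "0 < (\<mu> + l) * (u \<bullet> u)"
        using False \<open>0 \<le> \<mu> + l\<close> \<open>u \<noteq> 0\<close> by (intro mult_pos_pos) auto
      ultimately show False
        by linarith
    qed
    have "q = 0" if "double_map H q + l *\<^sub>R q = 0" for q
      using that ker[of "fst q"] ker[of "snd q"] by (cases q) (simp add: zero_prod_def)
    then show ?thesis
      by blast
  next
    case True
    define A where "A = H - mat \<mu>"
    have Av: "A *v u = H *v u + l *\<^sub>R u" for u
      by (simp add: A_def True matrix_vector_mult_diff_rdistrib mat_vector_mult)
    have psd: "psd_operator (\<lambda>u. A *v u)"
      unfolding Av by (rule quadratic.psd_operator_shift[OF quadratic_matrix[OF H] w])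
    have Aw: "A *v (- w) = c"
    proof -
      have "A *v (- w) = - (A *v w)"
        using matrix_vector_mult_scaleR[of A "-1" w] by simp
      also have "\<dots> = c"
        unfolding Av using w by (intro minus_unique) (simp add: kkt_def)
      finally show ?thesis .
    qed
    then have "c \<in> range (\<lambda>x. (H - mat (min_eigenvalue H)) *v x)"
      unfolding A_def \<mu>_def by (metis rangeI)
    moreover have "trs_multiplier H c = - min_eigenvalue H"
      using trs_multiplier_eq[OF H w] True by (simp add: \<mu>_def)
    ultimately have "norm (pseudoinverse A *v c) \<noteq> 1"
      using well by (simp add: ill_case_def A_def \<mu>_def)
    moreover have "norm (pseudoinverse A *v c) \<le> norm w"
      using pseudoinverse_least_norm(2)[OF psd Aw] by simp
    moreover have "norm w \<le> 1"
      using w by (simp add: kkt_def norm_le_square)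
    ultimately have less: "norm (pseudoinverse A *v c) < 1"
      by linarith
    define a where "a = - (pseudoinverse A *v c)"
    have "A *v a = - c"
      using pseudoinverse_least_norm(1)[OF psd Aw] matrix_vector_mult_scaleR[of A "-1" "pseudoinverse A *v c"]
      by (simp add: a_def)
    then have "double_map H (a, 0) + l *\<^sub>R (a, 0) + (c, 0) = 0"
      by (simp add: Av zero_prod_def)
    moreover have "norm (a, 0 :: real ^ 'n) < 1"
      using less by (simp add: a_def norm_Pair)
    ultimately show ?thesis
      by blast
  qed
qed

lemma pg_step_convergence:
  fixes z :: "nat \<Rightarrow> (real ^ 'n) \<times> (real ^ 'n)"
  assumes H: "transpose H = H" and \<eta>: "0 < \<eta>" "H \<noteq> 0 \<Longrightarrow> \<eta> < 2 / onorm (\<lambda>v. H *v v)"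
    and start: "z 0 \<in> ball2n" and iteration: "\<And>k. z (Suc k) = pg_step H c \<eta> (z k)"
    and v: "H *v v = min_eigenvalue H *\<^sub>R v" "v \<bullet> snd (z 0) \<noteq> 0"
  shows "\<exists>u l. z \<longlonglongrightarrow> u \<and> dbl_kkt H c u l \<and>
    (well_case H c \<longrightarrow> (\<exists>K C \<rho>. 0 \<le> C \<and> 0 < \<rho> \<and> \<rho> < 1 \<and>
       (\<forall>k\<ge>K. dbl_objective H c (z k) - dbl_optimal_value H c \<le> C * \<rho> ^ k))) \<and>
    (\<exists>K C. 1 \<le> K \<and> 0 \<le> C \<and>
       (\<forall>k\<ge>K. dbl_objective H c (z k) - dbl_optimal_value H c \<le> C / (real k)\<^sup>2))"
proof -
  define L where "L = onorm (\<lambda>v. H *v v)"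
  define m where "m k = max 1 (norm (z k - \<eta> *\<^sub>R (double_map H (z k) + (c, 0))))" for k
  have bl: "bounded_linear (\<lambda>v. H *v v)"
    by (rule matrix_vector_mul_bounded_linear)
  have upper: "x \<bullet> (H *v x) \<le> L * (x \<bullet> x)" for x
  proof -
    have "x \<bullet> (H *v x) \<le> norm x * norm (H *v x)"
      by (rule norm_cauchy_schwarz)
    also have "\<dots> \<le> norm x * (L * norm x)"
      unfolding L_def by (intro mult_left_mono onorm[OF bl]) auto
    finally show ?thesis
      by (simp add: power2_eq_square mult_ac flip: power2_norm_eq_inner)
  qed
  \<comment> \<open>In HOL \<open>2 / 0 = 0\<close>, so the step bound is stated for
    \<open>H \<noteq> 0\<close> only; for \<open>H = 0\<close> the product is 0.\<close>
  have \<eta>L: "\<eta> * L < 2"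
  proof (cases "H = 0")
    case True
    then show ?thesis
      by (simp add: L_def onorm_zero)
  next
    case False
    have "0 < L"
    proof -
      have "L \<noteq> 0"
        unfolding L_def using False by (auto simp: onorm_eq_0[OF bl] matrix_eq)
      then show ?thesis
        using onorm_pos_le[OF bl] by (simp add: L_def)
    qed
    then show ?thesis
      using \<eta>(2)[OF False] by (simp add: L_def field_simps)
  qed
  interpret projected_gradient "double_map H" "(c, 0)" \<eta> L m z
  proof (intro projected_gradient.intro projected_gradient_axioms.intro quadratic_double H \<eta>(1) \<eta>L)
    show "u \<bullet> double_map H u \<le> L * (u \<bullet> u)" for u
      using upper[of "fst u"] upper[of "snd u"] by (simp add: inner_prod_def distrib_left)
    show "norm (z 0) \<le> 1"
      using start by (simp add: mem_ball2n norm_le_square)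
    show "m k = max 1 (norm (z k - \<eta> *\<^sub>R (double_map H (z k) + (c, 0))))" for k
      by (rule m_def)
    show "m k *\<^sub>R z (Suc k) = z k - \<eta> *\<^sub>R (double_map H (z k) + (c, 0))" for k
    proof -
      obtain x y where zk: "z k = (x, y)"
        by fastforce
      have "m k = max (sqrt ((norm (x - \<eta> *\<^sub>R (H *v x + c)))\<^sup>2 + (norm (y - \<eta> *\<^sub>R (H *v y)))\<^sup>2)) 1"
        by (simp add: m_def zk norm_Pair max.commute)
      then have "z (Suc k) = (1 / m k) *\<^sub>R (z k - \<eta> *\<^sub>R (double_map H (z k) + (c, 0)))"
        by (simp add: iteration pg_step_def zk Let_def)
      moreover have "1 \<le> m k"
        by (simp add: m_def)
      ultimately show ?thesis
        by simp
    qed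
  qed
  have "\<exists>y l. kkt y l \<and> (\<lambda>k. obj (z k)) \<longlonglongrightarrow> obj y"
  proof (rule accumulates_at_kkt)
    \<comment> \<open>The purpose of the doubling: \<open>(0, v)\<close> is an eigenvector for the
      least eigenvalue and orthogonal to \<open>(c, 0)\<close> for every \<open>c\<close>, which
      \<open>v\<close> need not be to \<open>c\<close>.\<close>
    show "double_map H (0, v) = min_eigenvalue H *\<^sub>R (0, v)"
      by (simp add: v)
    show "(0, v) \<bullet> (c, 0) = 0"
      by simp
    show "(0, v) \<bullet> z 0 \<noteq> 0"
      using v(2) by (simp add: inner_prod_def)
    show "min_eigenvalue H * (u \<bullet> u) \<le> u \<bullet> double_map H u" for u
      using min_eigenvalue(2)[OF H, of "fst u"] min_eigenvalue(2)[OF H, of "snd u"]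
      by (simp add: inner_prod_def distrib_left)
  qed
  then obtain y l where y: "kkt y l" and lim: "(\<lambda>k. obj (z k)) \<longlonglongrightarrow> obj y"
    by blast
  obtain u where u: "z \<longlonglongrightarrow> u" "kkt u l"
    using limit_kkt[OF y lim] by blast
  have gap: "dbl_objective H c (z k) - dbl_optimal_value H c = obj (z k) - obj y" for k
    using dbl_minimizer_if_kkt(2)[OF H y] by (simp add: dbl_objective_eq[OF H])
  show ?thesis
    using u sublinear_rate[OF y lim] linear_rate[OF y lim] well_case_regular[OF H y]
    unfolding gap by blast
qed

section \<open>Almost sure convergence\<close>

lemma AE_lborel_hyperplane:
  fixes e :: "'a::euclidean_space"
  assumes "e \<noteq> 0"
  shows "AE z in lborel. e \<bullet> z \<noteq> 0"
proof -
  have "closed {z. e \<bullet> z = 0}"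
    by (intro closed_Collect_eq continuous_intros)
  then have "{z. e \<bullet> z = 0} \<in> sets lborel"
    by simp
  moreover have "{z. e \<bullet> z = 0} \<in> null_sets lebesgue"
    using negligible_hyperplane[of e 0] assms by (simp add: negligible_iff_null_sets)
  ultimately have "{z. e \<bullet> z = 0} \<in> null_sets lborel"
    by (simp add: null_sets_completion_iff)
  then show ?thesis
    by (rule AE_I') auto
qed

theorem corollary3p7:
  fixes H :: "real ^ 'n ^ 'n" and c :: "real ^ 'n" and \<eta> :: real
    and M :: "'w measure" and x y :: "nat \<Rightarrow> 'w \<Rightarrow> real ^ 'n"
  assumes H_symmetric: "transpose H = H"
    and step_pos: "0 < \<eta>"
    and step_bound: "H \<noteq> 0 \<Longrightarrow> \<eta> < 2 / onorm (\<lambda>v. H *v v)"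
    and prob: "prob_space M"
    and init_measurable: "(\<lambda>\<omega>. (x 0 \<omega>, y 0 \<omega>)) \<in> borel_measurable M"
    and init_uniform: "distr M borel (\<lambda>\<omega>. (x 0 \<omega>, y 0 \<omega>)) = uniform_measure lborel ball2n"
    and iteration: "\<And>k \<omega>. \<omega> \<in> space M \<Longrightarrow>
          (x (Suc k) \<omega>, y (Suc k) \<omega>) = pg_step H c \<eta> (x k \<omega>, y k \<omega>)"
  shows "AE \<omega> in M. \<exists>x_lim y_lim.
           (\<lambda>k. (x k \<omega>, y k \<omega>)) \<longlonglongrightarrow> (x_lim, y_lim) \<and>
           dbl_minimizer H c (x_lim, y_lim) \<and>
           trs_minimizer H c (recovered_point x_lim y_lim) \<and>
           (well_case H c \<longrightarrow>
              (\<exists>(K :: nat) C \<rho>. 0 \<le> C \<and> 0 < \<rho> \<and> \<rho> < 1 \<and>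
                 (\<forall>k\<ge>K. dbl_objective H c (x k \<omega>, y k \<omega>) - dbl_optimal_value H c \<le> C * \<rho> ^ k))) \<and>
           (ill_case H c \<longrightarrow>
              (\<exists>(K :: nat) C. 1 \<le> K \<and> 0 \<le> C \<and>
                 (\<forall>k\<ge>K. dbl_objective H c (x k \<omega>, y k \<omega>) - dbl_optimal_value H c \<le> C / (real k)\<^sup>2)))"
proof -
  obtain v where v: "v \<noteq> 0" "H *v v = min_eigenvalue H *\<^sub>R v"
    using min_eigenvalue(1)[OF H_symmetric] by (auto simp: is_eigenvalue_def)
  have ball: "(ball2n :: ((real ^ 'n) \<times> (real ^ 'n)) set) \<in> sets lborel"
  proof -
    have "(ball2n :: ((real ^ 'n) \<times> (real ^ 'n)) set) = cball 0 1"
      by (auto simp: mem_ball2n norm_le_square)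
    then show ?thesis
      by (metis borel_closed closed_cball sets_lborel)
  qed
  \<comment> \<open>Bad starting points form a null hyperplane. The statement passes from Lebesgue
    measure to the uniform measure on the ball and then, through the distribution of the start, to
    \<open>M\<close>.\<close>
  have "AE z in uniform_measure lborel ball2n. z \<in> ball2n \<and> v \<bullet> snd z \<noteq> 0"
  proof (rule AE_uniform_measureI[OF ball])
    have "AE z in lborel. (0 :: real ^ 'n, v) \<bullet> z \<noteq> 0"
      by (rule AE_lborel_hyperplane) (simp add: v zero_prod_def)
    then show "AE z in lborel. z \<in> ball2n \<longrightarrow> z \<in> ball2n \<and> v \<bullet> snd z \<noteq> 0"
      by (rule eventually_mono) (simp add: inner_prod_def)
  qed
  then have "AE \<omega> in M. (x 0 \<omega>, y 0 \<omega>) \<in> ball2n \<and> v \<bullet> snd (x 0 \<omega>, y 0 \<omega>) \<noteq> 0"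
    by (intro AE_distrD[OF init_measurable]) (simp only: init_uniform)
  then show ?thesis
    using AE_space
  proof eventually_elim
    case (elim \<omega>)
    obtain u l where u: "(\<lambda>k. (x k \<omega>, y k \<omega>)) \<longlonglongrightarrow> u" "dbl_kkt H c u l"
      and rates: "well_case H c \<longrightarrow> (\<exists>K C \<rho>. 0 \<le> C \<and> 0 < \<rho> \<and> \<rho> < 1 \<and>
         (\<forall>k\<ge>K. dbl_objective H c (x k \<omega>, y k \<omega>) - dbl_optimal_value H c \<le> C * \<rho> ^ k))"
      "\<exists>K C. 1 \<le> K \<and> 0 \<le> C \<and>
         (\<forall>k\<ge>K. dbl_objective H c (x k \<omega>, y k \<omega>) - dbl_optimal_value H c \<le> C / (real k)\<^sup>2)"
      using pg_step_convergence[of H \<eta> "\<lambda>k. (x k \<omega>, y k \<omega>)" c v, OF H_symmetric step_pos step_bound _ iteration v(2)]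
        elim by blast
    obtain x_lim y_lim where "u = (x_lim, y_lim)"
      by fastforce
    with u rates show ?case
      using dbl_minimizer_if_kkt(1)[OF H_symmetric] trs_minimizer_if_kkt[OF H_symmetric]
        recovered_point_kkt[OF H_symmetric] by blast
  qed
qed

end
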